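(* Let $G$ be a finite supersoluble group, let $N$ be a normal nilpotent subgroup of $G$, and let $J$ and $J'$ be complements of $N$ in $G$. Then $J$ and $J'$ are conjugate in $G$ if and only if they are locally conjugate in $G$.
   Context: A complement of a normal subgroup $N$ in $G$ is a subgroup $K\leq G$ with $G=NK$ and $N\cap K=1$. Two subgroups $H$ and $H'$ of a group $G$ are locally conjugate in $G$ if for each prime $p$, a Sylow $p$-subgroup of $H$ is conjugate in $G$ to a Sylow $p$-subgroup of $H'$. A finite group is supersoluble if it has a normal series (all terms normal in the whole group) with cyclic factors. *)

theory Defs
  imports "HOL-Algebra.Algebra"
begin

definition center :: "('a, 'b) monoid_scheme \<Rightarrow> 'a set"
  where "center G = {z \<in> carrier G. \<forall>x \<in> carrier G. z \<otimes>\<^bsub>G\<^esub> x = x \<otimes>\<^bsub>G\<^esub> z}"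

definition nilpotent_group :: "('a, 'b) monoid_scheme \<Rightarrow> bool"
  where "nilpotent_group G \<longleftrightarrow>
    (\<exists>(n::nat) Z. Z 0 = {\<one>\<^bsub>G\<^esub>} \<and> Z n = carrier G \<and>
       (\<forall>i\<le>n. Z i \<lhd> G) \<and>
       (\<forall>i<n. Z i \<subseteq> Z (Suc i) \<and>
          carrier (G\<lparr>carrier := Z (Suc i)\<rparr> Mod Z i) \<subseteq> center (G Mod Z i)))"

definition supersoluble :: "('a, 'b) monoid_scheme \<Rightarrow> bool"
  where "supersoluble G \<longleftrightarrow>
    (\<exists>(n::nat) S. S 0 = {\<one>\<^bsub>G\<^esub>} \<and> S n = carrier G \<and>
       (\<forall>i\<le>n. S i \<lhd> G) \<and>
       (\<forall>i<n. S i \<subseteq> S (Suc i) \<and>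
          cyclic_group (G\<lparr>carrier := S (Suc i)\<rparr> Mod S i)))"

definition is_complement :: "('a, 'b) monoid_scheme \<Rightarrow> 'a set \<Rightarrow> 'a set \<Rightarrow> bool"
  where "is_complement G N K \<longleftrightarrow>
    N \<lhd> G \<and> subgroup K G \<and> N <#>\<^bsub>G\<^esub> K = carrier G \<and> N \<inter> K = {\<one>\<^bsub>G\<^esub>}"

definition conjugate_in :: "('a, 'b) monoid_scheme \<Rightarrow> 'a set \<Rightarrow> 'a set \<Rightarrow> bool"
  where "conjugate_in G H K \<longleftrightarrow>
    (\<exists>g \<in> carrier G. K = (g <#\<^bsub>G\<^esub> H) #>\<^bsub>G\<^esub> (inv\<^bsub>G\<^esub> g))"

text \<open>
  The Sylow \<open>p\<close>-subgroups of a finite group \<open>G\<close>. If \<open>p\<close> does not divide the order of \<open>G\<close>,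
  the only one is the trivial subgroup.
\<close>

definition sylow_subgroup :: "('a, 'b) monoid_scheme \<Rightarrow> nat \<Rightarrow> 'a set \<Rightarrow> bool"
  where "sylow_subgroup G p P \<longleftrightarrow> subgroup P G \<and> card P = p ^ multiplicity p (order G)"

definition locally_conjugate :: "('a, 'b) monoid_scheme \<Rightarrow> 'a set \<Rightarrow> 'a set \<Rightarrow> bool"
  where "locally_conjugate G H H' \<longleftrightarrow>
    (\<forall>p::nat. Factorial_Ring.prime p \<longrightarrow>
       (\<exists>P P'. sylow_subgroup (G\<lparr>carrier := H\<rparr>) p P \<and>
               sylow_subgroup (G\<lparr>carrier := H'\<rparr>) p P' \<and>
               conjugate_in G P P'))"

end

theory Submission
  imports Defs
begin

text \<open>
  Two complements \<open>J\<close> and \<open>J'\<close> of \<open>N\<close> differ by a crossed homomorphism \<open>c\<close> from \<open>J\<close> to \<open>N\<close>: the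
  elements of \<open>J'\<close> are the \<open>c x \<otimes> x\<close> with \<open>x \<in> J\<close>. They are conjugate if \<open>c\<close> is principal,
  \<open>c x = n \<otimes> inv (conj_by G x n)\<close> for some \<open>n \<in> N\<close>, and local conjugacy says that for each prime
  \<open>q\<close> the restriction of \<open>c\<close> to some Sylow \<open>q\<close>-subgroup \<open>Q\<close> of \<open>J\<close> is principal. The nontrivial
  implication is therefore a local-global principle for a first cohomology set with coefficients
  in the nilpotent group \<open>N\<close>.

  A finite nilpotent group is the direct product of its Sylow subgroups, and the projections are
  power maps (\<open>nilpotent_pow_mult_distrib\<close>), hence compatible with conjugation. So one may
  project \<open>c\<close> to a Sylow \<open>q\<close>-subgroup \<open>A\<close> of \<open>N\<close>, treat the primes one at a time, and put the results
  together at the end (\<open>crossed_hom_principal_if_locally_principal\<close>). After a twist, \<open>c\<close> is trivial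
  on \<open>Q\<close>.

  Were \<open>A\<close> abelian, an averaging argument would finish the proof for any group. For nonabelian \<open>A\<close>
  supersolubility is used: automorphism groups of cyclic groups are abelian, so commutators act
  trivially on the factors of a normal series with cyclic factors, and an element of the commutator
  subgroup of order prime to \<open>q\<close> centralizes \<open>A\<close> (\<open>supersoluble_commutators_act_nearly_trivially\<close>). On the
  cyclic group generated by such an element, \<open>c\<close> is a homomorphism to a \<open>q\<close>-group, so it is trivial
  there. Together with the triviality on \<open>Q\<close> this shows that \<open>c\<close> is trivial on all commutators of \<open>J\<close>
  (\<open>crossed_hom_principal_if_trivial_on_sylow\<close>). What is left is an abelian group of order prime
  to \<open>q\<close> that acts on a \<open>q\<close>-group by the affine maps \<open>a \<mapsto> c x \<otimes> conj_by G x a\<close>, and fixed points are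
  found by counting cycles, for one element of prime order at a time
  (\<open>crossed_hom_principal_if_abelian_mod_kernel\<close>).
\<close>

section \<open>Conjugation, powers and Sylow subgroups\<close>

text \<open>
  Written with \<open>conj_by\<close> instead of explicit products, the identities for conjugation orient
  well as rewrite rules; nearly all later computations go through them.
\<close>
definition conj_by :: "('a, 'b) monoid_scheme \<Rightarrow> 'a \<Rightarrow> 'a \<Rightarrow> 'a"
  where "conj_by G g x = g \<otimes>\<^bsub>G\<^esub> x \<otimes>\<^bsub>G\<^esub> inv\<^bsub>G\<^esub> g"

context group
begin

lemma inv_m_cancel [simp]:
  assumes "x \<in> carrier G" "y \<in> carrier G"
  shows "inv x \<otimes> (x \<otimes> y) = y" "x \<otimes> (inv x \<otimes> y) = y"
  using assms by (simp_all flip: m_assoc)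

lemma conj_by_closed [simp]: "g \<in> carrier G \<Longrightarrow> x \<in> carrier G \<Longrightarrow> conj_by G g x \<in> carrier G"
  by (simp add: conj_by_def)

lemma conj_by_mult:
  "g \<in> carrier G \<Longrightarrow> x \<in> carrier G \<Longrightarrow> y \<in> carrier G \<Longrightarrow>
    conj_by G g (x \<otimes> y) = conj_by G g x \<otimes> conj_by G g y"
  by (simp add: conj_by_def m_assoc)

lemma conj_by_inv:
  "g \<in> carrier G \<Longrightarrow> x \<in> carrier G \<Longrightarrow> conj_by G g (inv x) = inv (conj_by G g x)"
  by (simp add: conj_by_def m_assoc inv_mult_group)

lemma conj_by_conj_by:
  "g \<in> carrier G \<Longrightarrow> h \<in> carrier G \<Longrightarrow> x \<in> carrier G \<Longrightarrow>
    conj_by G (g \<otimes> h) x = conj_by G g (conj_by G h x)"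
  by (simp add: conj_by_def m_assoc inv_mult_group)

lemma conj_by_one [simp]: "x \<in> carrier G \<Longrightarrow> conj_by G \<one> x = x"
  "g \<in> carrier G \<Longrightarrow> conj_by G g \<one> = \<one>"
  by (simp_all add: conj_by_def)

lemma conj_by_inv_cancel [simp]:
  assumes "g \<in> carrier G" "x \<in> carrier G"
  shows "conj_by G g (conj_by G (inv g) x) = x" "conj_by G (inv g) (conj_by G g x) = x"
  using assms by (simp_all flip: conj_by_conj_by)

lemma conj_by_eq_self_iff:
  "g \<in> carrier G \<Longrightarrow> x \<in> carrier G \<Longrightarrow> conj_by G g x = x \<longleftrightarrow> g \<otimes> x = x \<otimes> g"
  by (metis conj_by_def inv_solve_right' m_closed)

lemma conj_by_group_hom: "g \<in> carrier G \<Longrightarrow> group_hom G G (conj_by G g)"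
  by unfold_locales (simp add: hom_def conj_by_mult)

lemma conj_by_nat_pow:
  "g \<in> carrier G \<Longrightarrow> x \<in> carrier G \<Longrightarrow> conj_by G g (x [^] (k::nat)) = conj_by G g x [^] k"
  using group_hom.hom_nat_pow[OF conj_by_group_hom] .

lemma conj_by_int_pow:
  "g \<in> carrier G \<Longrightarrow> x \<in> carrier G \<Longrightarrow> conj_by G g (x [^] (k::int)) = conj_by G g x [^] k"
  using group_hom.hom_int_pow[OF conj_by_group_hom] .

lemma normal_conj_by: "N \<lhd> G \<Longrightarrow> g \<in> carrier G \<Longrightarrow> x \<in> N \<Longrightarrow> conj_by G g x \<in> N"
  by (simp add: conj_by_def normal.inv_op_closed2)

lemma normalI_conj_by:
  "subgroup N G \<Longrightarrow> (\<And>g x. g \<in> carrier G \<Longrightarrow> x \<in> N \<Longrightarrow> conj_by G g x \<in> N) \<Longrightarrow> N \<lhd> G"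
  by (simp add: conj_by_def normal_inv_iff)

lemma subgroup_nat_pow: "subgroup H G \<Longrightarrow> x \<in> H \<Longrightarrow> x [^] (k::nat) \<in> H"
  by (metis subgroup_int_pow_closed int_pow_int)

text \<open>
  Inverses in a finite group are positive powers, so closure under products suffices.
\<close>
lemma finite_subgroupI:
  assumes "finite (carrier G)" "H \<subseteq> carrier G" "\<one> \<in> H" "\<And>x y. x \<in> H \<Longrightarrow> y \<in> H \<Longrightarrow> x \<otimes> y \<in> H"
  shows "subgroup H G"
proof (rule subgroupI)
  fix x assume x: "x \<in> H"
  then have xG: "x \<in> carrier G" using assms by blast
  have p: "x [^] k \<in> H" for k :: nat by (induction k) (use assms x in auto)
  have "x [^] (order G - 1) \<otimes> x = \<one>"
    using pow_order_eq_1[OF xG] order_gt_0_iff_finite assms(1) nat_pow_Suc[of x "order G - 1"] by simp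
  then show "inv x \<in> H" using p[of "order G - 1"] xG by (metis inv_equality nat_pow_closed)
qed (use assms in auto)

lemma pow_card_subgroup:
  assumes "subgroup H G" "x \<in> H"
  shows "x [^] card H = \<one>"
  using group.pow_order_eq_1[OF subgroup.subgroup_is_group[OF assms(1) is_group], of x] assms
  by (simp add: order_def nat_pow_consistent[symmetric])

text \<open>
  By Bezout, \<open>x\<close> is a product of powers of \<open>x [^] m\<close> and \<open>x [^] n\<close>.
\<close>
lemma coprime_pow_mem:
  assumes "subgroup H G" "x \<in> carrier G" "x [^] (m::nat) \<in> H" "x [^] (n::nat) \<in> H" "coprime m n"
  shows "x \<in> H"
proof -
  obtain u v where uv: "u * int m + v * int n = 1"
    using assms(5) by (metis bezout_int coprime_iff_gcd_eq_1 gcd_int_int_eq of_nat_1)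
  have "x = x [^] (int m * u + int n * v)" using uv assms(2) by (simp add: mult.commute)
  also have "\<dots> = (x [^] int m) [^] u \<otimes> (x [^] int n) [^] v"
    using assms(2) by (simp add: int_pow_mult int_pow_pow)
  also have "\<dots> \<in> H"
    using assms by (simp add: int_pow_int subgroup_int_pow_closed subgroup.m_closed)
  finally show ?thesis .
qed

lemma coprime_pow_eq_one:
  assumes "x \<in> carrier G" "x [^] (m::nat) = \<one>" "x [^] (n::nat) = \<one>" "coprime m n"
  shows "x = \<one>"
  using coprime_pow_mem[of "{\<one>}" x m n] assms triv_subgroup by auto

lemma card_subgroup_dvd:
  assumes "subgroup H G" "subgroup K G" "H \<subseteq> K"
  shows "card H dvd card K"
proof -
  have "subgroup H (G\<lparr>carrier := K\<rparr>)" using assms by (rule subgroup_incl)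
  then show ?thesis
    using group.lagrange[OF subgroup.subgroup_is_group[OF assms(2) is_group], of H]
    by (auto simp: order_def dest: sym)
qed

lemma sylow_exists:
  assumes "finite (carrier G)" "subgroup J G" "Factorial_Ring.prime p"
  shows "\<exists>P. subgroup P G \<and> P \<subseteq> J \<and> card P = p ^ multiplicity p (card J)"
proof -
  interpret J: group "G\<lparr>carrier := J\<rparr>" using assms(2) subgroup.subgroup_is_group is_group by blast
  have fin: "finite J" using assms(1,2) finite_subset subgroup.subset by blast
  obtain m where "card J = p ^ multiplicity p (card J) * m"
    using multiplicity_dvd by (metis dvdE)
  then obtain P where "subgroup P (G\<lparr>carrier := J\<rparr>)" "card P = p ^ multiplicity p (card J)"
    using sylow_thm[OF assms(3) J.is_group, of "multiplicity p (card J)" m] fin by (auto simp: order_def)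
  then show ?thesis using assms(2) incl_subgroup subgroup.subset by fastforce
qed

text \<open>
  Counting: the hypotheses put a full Sylow subgroup of \<open>J\<close> inside \<open>K\<close> for every prime,
  so \<open>card J\<close> divides \<open>card K\<close>. For \<open>r \<noteq> q\<close> the Sylow subgroup is caught through its elements, all
  of \<open>r\<close>-power order. This stands in for conjugacy of Sylow subgroups throughout.
\<close>
lemma subgroup_eq_if_contains_sylows:
  assumes "finite (carrier G)" "subgroup J G" "subgroup K G" "K \<subseteq> J"
    and "subgroup Q G" "Q \<subseteq> K" "card Q = q ^ multiplicity q (card J)" "Factorial_Ring.prime q"
    and "\<And>x r k. x \<in> J \<Longrightarrow> Factorial_Ring.prime r \<Longrightarrow> r \<noteq> q \<Longrightarrow> x [^] (r ^ k :: nat) = \<one> \<Longrightarrow> x \<in> K"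
  shows "K = J"
proof -
  have fin: "finite J" using assms(1,2) finite_subset subgroup.subset by blast
  have nz: "card J \<noteq> 0" "card K \<noteq> 0"
    using fin assms(2,3,4) finite_subset subgroup.one_closed by (metis card_0_eq empty_iff)+
  have "card J dvd card K"
  proof (rule multiplicity_le_imp_dvd)
    fix r :: nat assume r: "Factorial_Ring.prime r"
    have "r ^ multiplicity r (card J) dvd card K"
    proof (cases "r = q")
      case True
      then show ?thesis using card_subgroup_dvd[OF assms(5,3,6)] assms(7) by simp
    next
      case False
      obtain R where R: "subgroup R G" "R \<subseteq> J" "card R = r ^ multiplicity r (card J)"
        using sylow_exists[OF assms(1,2) r] by blast
      have "R \<subseteq> K"
      proof
        fix x assume x: "x \<in> R"
        show "x \<in> K" using assms(9)[OF _ r False, of x "multiplicity r (card J)"]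
          x R pow_card_subgroup[OF R(1) x] by auto
      qed
      then show ?thesis using card_subgroup_dvd[OF R(1) assms(3)] R(3) by simp
    qed
    then show "multiplicity r (card J) \<le> multiplicity r (card K)"
      using nz r by (intro multiplicity_geI) auto
  qed (use nz in auto)
  then show ?thesis using fin assms(4) nz by (meson card_seteq dvd_imp_le not_gr_zero)
qed

end

section \<open>Crossed homomorphisms into a group of prime power order\<close>

text \<open>
  The points that move lie in cycles of length exactly \<open>r\<close>, so the number of fixed points is
  congruent to \<open>card S\<close> modulo \<open>r\<close>.
\<close>
lemma fixed_point_of_prime_period:
  fixes f :: "'s \<Rightarrow> 's"
  assumes fin: "finite S" and fS: "\<And>s. s \<in> S \<Longrightarrow> f s \<in> S"
    and per: "\<And>s. s \<in> S \<Longrightarrow> (f ^^ r) s = s"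
    and r: "Factorial_Ring.prime r" and ndvd: "\<not> r dvd card S"
  shows "\<exists>s\<in>S. f s = s"
proof (rule ccontr)
  assume nofix: "\<not> ?thesis"
  define orb where "orb = (\<lambda>s. (\<lambda>i. (f ^^ i) s) ` {..<r})"
  have r0: "r > 1" using r prime_gt_1_nat by blast
  have pow_S: "(f ^^ i) s \<in> S" if "s \<in> S" for i s
    by (induction i) (use that fS in auto)
  have mem: "(f ^^ i) s \<in> orb s" if "s \<in> S" for i s
    using funpow_mod_eq[OF per[OF that], of i] r0 unfolding orb_def
    by (intro image_eqI[of _ _ "i mod r"]) auto
  have sub: "orb t \<subseteq> orb s" if st: "s \<in> S" "t \<in> S" "orb s \<inter> orb t \<noteq> {}" for s t
  proof -
    obtain i j where ij: "(f ^^ i) s = (f ^^ j) t" using st(3) unfolding orb_def by auto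
    have "(f ^^ (j * (r - 1) + j)) t = (f ^^ (j * r)) t"
      using r0 by (simp add: algebra_simps)
    also have "\<dots> = (f ^^ (j * r mod r)) t" using funpow_mod_eq[OF per[OF st(2)], of "j * r"] by simp
    finally have t: "t = (f ^^ (j * (r - 1) + i)) s" using ij by (simp add: funpow_add)
    show ?thesis
    proof
      fix u assume "u \<in> orb t"
      then obtain k where "u = (f ^^ k) t" unfolding orb_def by blast
      then have "u = (f ^^ (k + (j * (r - 1) + i))) s" using t by (simp add: funpow_add)
      then show "u \<in> orb s" using mem[OF st(1)] by simp
    qed
  qed
  have card: "card (orb s) = r" if s: "s \<in> S" for s
  proof -
    have False if ij: "i < j" "j < r" "(f ^^ i) s = (f ^^ j) s" for i j
    proof -
      define d where "d = j - i"
      have "(f ^^ ((r - i) + j)) s = (f ^^ ((r - i) + i)) s" using ij(3) by (simp add: funpow_add)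
      also have "\<dots> = s" using per[OF s] ij by simp
      also have "(r - i) + j = d + r" using ij d_def by simp
      finally have d: "(f ^^ d) s = s" using per[OF s] by (simp add: funpow_add)
      have "coprime d r" using ij r d_def
        by (metis coprime_commute diff_is_0_eq dvd_imp_le less_imp_diff_less not_le prime_imp_coprime_nat not_gr_zero)
      moreover have "d \<noteq> 0" using ij d_def by simp
      ultimately obtain u v where "d * u = r * v + 1" using bezout_nat[of d r] by auto
      then have u: "(d * u) mod r = 1" using r0 by (simp add: mod_Suc)
      have "(f ^^ (d * u)) s = s" using funpow_mod_eq[OF d, of "d * u"] by simp
      then have "f s = s" using u funpow_mod_eq[OF per[OF s], of "d * u"] by simp
      then show False using nofix s by blast
    qed
    then have "inj_on (\<lambda>i. (f ^^ i) s) {..<r}"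
      by (intro linorder_inj_onI) auto
    then show ?thesis unfolding orb_def by (simp add: card_image)
  qed
  have "r dvd card (\<Union> (orb ` S))"
  proof (rule dvd_partition)
    have "orb s \<subseteq> S" if "s \<in> S" for s using pow_S[OF that] unfolding orb_def by blast
    then show "finite (\<Union> (orb ` S))" using fin by (meson UN_least finite_subset)
  next
    show "\<forall>c\<in>orb ` S. r dvd card c" using card by auto
    show "\<forall>c1\<in>orb ` S. \<forall>c2\<in>orb ` S. c1 \<noteq> c2 \<longrightarrow> c1 \<inter> c2 = {}"
      using sub by (metis (no_types, lifting) Int_commute imageE subset_antisym)
  qed
  moreover have "\<Union> (orb ` S) = S"
  proof
    show "\<Union> (orb ` S) \<subseteq> S" using pow_S unfolding orb_def by auto
    show "S \<subseteq> \<Union> (orb ` S)" using mem[of _ 0] by auto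
  qed
  ultimately show False using ndvd by simp
qed

text \<open>
  A crossed homomorphism (1-cocycle) for the conjugation action of \<open>J\<close> on \<open>A\<close>, with \<open>A\<close> not
  necessarily abelian. Equivalently, \<open>x \<mapsto> c x \<otimes> x\<close> is multiplicative on \<open>J\<close>. Crossed homomorphisms of
  the form \<open>x \<mapsto> n \<otimes> inv (conj_by G x n)\<close> are called principal below: they are the ones with
  \<open>c x \<otimes> x = conj_by G n x\<close>.
\<close>
definition crossed_hom :: "('a, 'b) monoid_scheme \<Rightarrow> 'a set \<Rightarrow> 'a set \<Rightarrow> ('a \<Rightarrow> 'a) \<Rightarrow> bool"
  where "crossed_hom G J A c \<longleftrightarrow> c \<in> J \<rightarrow> A \<and>
    (\<forall>x\<in>J. \<forall>y\<in>J. c (x \<otimes>\<^bsub>G\<^esub> y) = c x \<otimes>\<^bsub>G\<^esub> conj_by G x (c y))"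

text \<open>
  For a prime \<open>b\<close> these are the elements of \<open>b\<close>-power order; for a general \<open>b\<close> the elements
  whose order has only prime factors dividing \<open>b\<close>.
\<close>
definition torsion_part :: "('a, 'b) monoid_scheme \<Rightarrow> nat \<Rightarrow> 'a set \<Rightarrow> 'a set"
  where "torsion_part G b H = {x \<in> H. \<exists>k::nat. x [^]\<^bsub>G\<^esub> (b ^ k) = \<one>\<^bsub>G\<^esub>}"

definition torsion_group :: "('a, 'b) monoid_scheme \<Rightarrow> nat \<Rightarrow> 'a set \<Rightarrow> bool"
  where "torsion_group G b A \<longleftrightarrow> (\<forall>x\<in>A. \<exists>k::nat. x [^]\<^bsub>G\<^esub> (b ^ k) = \<one>\<^bsub>G\<^esub>)"

context group
begin

text \<open>
  Cauchy's theorem in contrapositive form: a nontrivial Sylow \<open>r\<close>-subgroup of \<open>A\<close> would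
  consist of elements that have both \<open>q\<close>-power and \<open>r\<close>-power order.
\<close>
lemma torsion_group_prime_not_dvd:
  assumes "finite (carrier G)" "subgroup A G" "torsion_group G q A"
    "Factorial_Ring.prime q" "Factorial_Ring.prime r" "r \<noteq> q"
  shows "\<not> r dvd card A"
proof
  assume dvd: "r dvd card A"
  have "card A \<noteq> 0" using assms(1,2) by (metis card_0_eq empty_iff finite_subset subgroup.one_closed subgroup.subset)
  then have m: "multiplicity r (card A) > 0" using dvd assms(5)
    by (simp add: prime_multiplicity_gt_zero_iff)
  obtain P where P: "subgroup P G" "P \<subseteq> A" "card P = r ^ multiplicity r (card A)"
    using sylow_exists[OF assms(1,2,5)] by blast
  have "P \<subseteq> {\<one>}"
  proof
    fix x assume x: "x \<in> P"
    obtain k where "x [^] (q ^ k) = \<one>" using assms(3) x P(2) unfolding torsion_group_def by blast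
    moreover have "x [^] (r ^ multiplicity r (card A)) = \<one>" using pow_card_subgroup[OF P(1) x] P(3) by simp
    moreover have "coprime (q ^ k) (r ^ multiplicity r (card A))"
      using assms(4,5,6) by (simp add: primes_coprime)
    ultimately show "x \<in> {\<one>}"
      using coprime_pow_eq_one[OF subgroup.mem_carrier[OF P(1) x]] by simp
  qed
  then have "card P \<le> 1" using card_mono[of "{\<one>}" P] by simp
  moreover have "1 < r ^ multiplicity r (card A)"
    using m prime_gt_1_nat[OF assms(5)] by (intro one_less_power)
  ultimately show False using P(3) by simp
qed

context
  fixes J A c
  assumes fin: "finite (carrier G)" and J: "subgroup J G" and A: "A \<lhd> G"
    and c: "crossed_hom G J A c"
begin

lemma crossed_hom_mem: "x \<in> J \<Longrightarrow> c x \<in> A"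
  using c by (auto simp: crossed_hom_def)

lemma crossed_hom_carrier: "x \<in> J \<Longrightarrow> c x \<in> carrier G" "x \<in> J \<Longrightarrow> x \<in> carrier G"
  using crossed_hom_mem subgroup.subset[OF normal_imp_subgroup[OF A]] subgroup.subset[OF J] by auto

lemma crossed_hom_mult: "x \<in> J \<Longrightarrow> y \<in> J \<Longrightarrow> c (x \<otimes> y) = c x \<otimes> conj_by G x (c y)"
  using c by (auto simp: crossed_hom_def)

lemma crossed_hom_one: "c \<one> = \<one>"
  using crossed_hom_mult[of \<one> \<one>] J crossed_hom_carrier[of \<one>] by (simp add: subgroup.one_closed)

lemma crossed_hom_kernel_subgroup: "subgroup {x \<in> J. c x = \<one>} G"
  using fin J crossed_hom_one crossed_hom_carrier
  by (intro finite_subgroupI) (auto simp: crossed_hom_mult subgroup.one_closed subgroup.m_closed)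

text \<open>
  The twist replaces \<open>c\<close> by a cohomologous crossed homomorphism; on the level of complements it
  conjugates the group of all \<open>c x \<otimes> x\<close> by \<open>inv n\<close>.
\<close>
lemma crossed_hom_twist:
  assumes "n \<in> A"
  shows "crossed_hom G J A (\<lambda>x. inv n \<otimes> c x \<otimes> conj_by G x n)"
proof -
  interpret A: subgroup A G using A by (rule normal_imp_subgroup)
  have "inv n \<otimes> c (x \<otimes> y) \<otimes> conj_by G (x \<otimes> y) n =
      inv n \<otimes> c x \<otimes> conj_by G x n \<otimes> conj_by G x (inv n \<otimes> c y \<otimes> conj_by G y n)"
    if "x \<in> J" "y \<in> J" for x y
    using that assms crossed_hom_carrier
    by (simp add: crossed_hom_mult conj_by_mult conj_by_inv conj_by_conj_by m_assoc)
  then show ?thesis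
    using assms crossed_hom_mem crossed_hom_carrier normal_conj_by[OF A] by (auto simp: crossed_hom_def)
qed

text \<open>
  Left multiplication by \<open>c x\<close> after conjugation by \<open>x\<close> is an affine action of \<open>J\<close> on \<open>A\<close>. A
  common fixed point \<open>n\<close> of this action is the same thing as \<open>c x = n \<otimes> inv (conj_by G x n)\<close>.
\<close>
lemma crossed_hom_affine_pow:
  assumes "x \<in> J" "a \<in> carrier G"
  shows "((\<lambda>a. c x \<otimes> conj_by G x a) ^^ k) a = c (x [^] k) \<otimes> conj_by G (x [^] k) a"
proof (induction k)
  case 0
  then show ?case using assms crossed_hom_one by simp
next
  case (Suc k)
  have xk: "x [^] k \<in> J" using subgroup_nat_pow[OF J assms(1)] .
  have "x [^] Suc k = x \<otimes> x [^] k" using nat_pow_Suc2 crossed_hom_carrier assms by blast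
  then show ?case
    using Suc xk assms crossed_hom_carrier
    by (simp add: crossed_hom_mult conj_by_mult conj_by_conj_by m_assoc)
qed

end

text \<open>
  If \<open>m\<close> trivialises the twist of a crossed homomorphism by \<open>n\<close>, then \<open>n \<otimes> m\<close> trivialises the
  crossed homomorphism itself; \<open>y\<close> stands for its value at \<open>x\<close>.
\<close>
lemma principal_if_twist_principal:
  assumes "x \<in> carrier G" "y \<in> carrier G" "n \<in> carrier G" "m \<in> carrier G"
    and "inv n \<otimes> y \<otimes> conj_by G x n = m \<otimes> inv (conj_by G x m)"
  shows "y = (n \<otimes> m) \<otimes> inv (conj_by G x (n \<otimes> m))"
proof -
  have "y = n \<otimes> (inv n \<otimes> y \<otimes> conj_by G x n) \<otimes> inv (conj_by G x n)"
    using assms(1-4) by (simp add: m_assoc)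
  then show ?thesis unfolding assms(5) using assms(1-4) by (simp add: conj_by_mult inv_mult_group m_assoc)
qed

text \<open>
  Enlarge the kernel \<open>K\<close> of \<open>c\<close> by twisting until it is all of \<open>J\<close>. It contains all commutators,
  so it is normal, and \<open>c\<close> takes values in the centralizer \<open>C\<close> of \<open>K\<close> in \<open>A\<close>. It contains a Sylow
  \<open>q\<close>-subgroup, so if \<open>K \<noteq> J\<close> there is \<open>x \<notin> K\<close> with \<open>x [^] r \<in> K\<close> for a prime \<open>r \<noteq> q\<close>. The affine
  action of \<open>x\<close> on \<open>C\<close> then has period \<open>r\<close>, while \<open>card C\<close> is prime to \<open>r\<close>: it fixes some \<open>n \<in> C\<close>, and
  twisting by \<open>n\<close> keeps \<open>K\<close> in the kernel and adds \<open>x\<close>. Adding one element at a time avoids both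
  averaging over \<open>J\<close>, which needs \<open>A\<close> abelian, and the Schur-Zassenhaus theorem.
\<close>
lemma crossed_hom_principal_if_abelian_mod_kernel:
  assumes fin: "finite (carrier G)" and J: "subgroup J G" and A: "A \<lhd> G"
    and q: "Factorial_Ring.prime q" and tor: "torsion_group G q A"
    and Q: "subgroup Q G" "Q \<subseteq> J" "card Q = q ^ multiplicity q (card J)"
    and "crossed_hom G J A c" and "\<And>x. x \<in> Q \<Longrightarrow> c x = \<one>"
    and "\<And>x y. x \<in> J \<Longrightarrow> y \<in> J \<Longrightarrow> c (conj_by G x y \<otimes> inv y) = \<one>"
  shows "\<exists>n\<in>A. \<forall>x\<in>J. c x = n \<otimes> inv (conj_by G x n)"
  using assms(9-11)
proof (induction "card J - card {x \<in> J. c x = \<one>}" arbitrary: c rule: less_induct)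
  case less
  note c = less.prems(1) and cQ = less.prems(2) and ccomm = less.prems(3)
  interpret A: subgroup A G using A by (rule normal_imp_subgroup)
  interpret J: subgroup J G by (rule J)
  note mult = crossed_hom_mult[OF fin J A c]
  note AA = crossed_hom_mem[OF fin J A c]
  define K where "K = {x \<in> J. c x = \<one>}"
  have finJ: "finite J" using fin finite_subset J.subset by blast
  have K: "subgroup K G" unfolding K_def by (rule crossed_hom_kernel_subgroup[OF fin J A c])
  interpret K: subgroup K G by (rule K)
  have KJ: "K \<subseteq> J" "\<And>k. k \<in> K \<Longrightarrow> c k = \<one>" by (auto simp: K_def)
  have Knorm: "conj_by G x k \<in> K" if "x \<in> J" "k \<in> K" for x k
  proof -
    have kJ: "k \<in> J" using that KJ by blast
    have "conj_by G x k \<otimes> inv k \<in> K"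
      using ccomm[OF that(1) kJ] that(1) kJ J.m_inv_closed J.m_closed by (auto simp: K_def conj_by_def)
    then have "conj_by G x k \<otimes> inv k \<otimes> k \<in> K" using that by blast
    then show ?thesis using that kJ by (simp add: m_assoc)
  qed
  show ?case
  proof (cases "K = J")
    case True
    then have "\<forall>x\<in>J. c x = \<one> \<otimes> inv (conj_by G x \<one>)" using KJ(2) by simp
    then show ?thesis using A.one_closed by blast
  next
    case False
    have "\<exists>y\<in>J - K. \<exists>r k. Factorial_Ring.prime r \<and> r \<noteq> q \<and> y [^] (r ^ k :: nat) = \<one>"
    proof (rule ccontr)
      assume "\<not> ?thesis"
      then have "K = J"
        using Q cQ by (intro subgroup_eq_if_contains_sylows[OF fin J K KJ(1) Q(1) _ Q(3) q]) (auto simp: K_def)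
      then show False using False by contradiction
    qed
    then obtain y r k where y: "y \<in> J" "y \<notin> K" and r: "Factorial_Ring.prime r" "r \<noteq> q"
      and yk: "y [^] (r ^ k :: nat) = \<one>" by blast
    \<comment> \<open>The last power of \<open>y\<close> outside \<open>K\<close> along the exponents \<open>r ^ i\<close> has its \<open>r\<close>-th power in \<open>K\<close>.\<close>
    define i where "i = (LEAST i. y [^] (r ^ i :: nat) \<in> K)"
    have iK: "y [^] (r ^ i :: nat) \<in> K"
      unfolding i_def by (rule LeastI[of _ k]) (simp add: yk)
    have i0: "i \<noteq> 0" using iK y by (intro notI) simp
    define x where "x = y [^] (r ^ (i - 1) :: nat)"
    have xK: "x \<notin> K"
      using not_less_Least[of "i - 1" "\<lambda>i. y [^] (r ^ i :: nat) \<in> K", folded i_def] i0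
      unfolding x_def by simp
    have xJ: "x \<in> J" unfolding x_def using subgroup_nat_pow[OF J y(1)] .
    have "x [^] r = y [^] (r ^ i)" unfolding x_def using i0 y(1)
      by (cases i) (simp_all add: nat_pow_pow mult.commute)
    then have xr: "x [^] r \<in> K" using iK by simp
    define C where "C = {a \<in> A. \<forall>k\<in>K. conj_by G k a = a}"
    have CA: "C \<subseteq> A" by (auto simp: C_def)
    have C: "subgroup C G"
      using fin by (intro finite_subgroupI) (auto simp: C_def conj_by_mult)
    have Cx: "conj_by G x a \<in> C" if a: "a \<in> C" for a
    proof -
      have "conj_by G k (conj_by G x a) = conj_by G x a" if k: "k \<in> K" for k
      proof -
        define k' where "k' = conj_by G (inv x) k"
        have k': "k' \<in> K" using Knorm k xJ unfolding k'_def by blast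
        have aG: "a \<in> carrier G" using a subgroup.mem_carrier[OF C] by blast
        have "k \<otimes> x = x \<otimes> k'" using xJ k by (simp add: conj_by_def m_assoc k'_def)
        then have "conj_by G k (conj_by G x a) = conj_by G x (conj_by G k' a)"
          using xJ k k' aG by (metis J.mem_carrier K.mem_carrier conj_by_conj_by)
        then show ?thesis using a k' by (simp add: C_def)
      qed
      then show ?thesis using a CA xJ normal_conj_by[OF A] by (auto simp: C_def)
    qed
    have cC: "c x \<in> C"
    proof -
      have "conj_by G k (c x) = c x" if k: "k \<in> K" for k
      proof -
        define k' where "k' = conj_by G (inv x) k"
        have k': "k' \<in> K" using Knorm k xJ unfolding k'_def by blast
        have "k \<otimes> x = x \<otimes> k'" using xJ k by (simp add: conj_by_def m_assoc k'_def)
        \<comment> \<open>Evaluating \<open>c\<close> on both sides, with \<open>c\<close> trivial on \<open>k\<close> and \<open>k'\<close>, gives \<open>conj_by G k (c x) = c x\<close>.\<close>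
        then have "c (k \<otimes> x) = c (x \<otimes> k')" by simp
        then show ?thesis using k k' xJ KJ AA by (simp add: mult subsetD)
      qed
      then show ?thesis using AA xJ by (simp add: C_def)
    qed
    have "\<exists>n\<in>C. c x \<otimes> conj_by G x n = n"
    proof (rule fixed_point_of_prime_period[OF _ _ _ r(1)])
      show "finite C" using fin C subgroup.subset finite_subset by blast
      show "c x \<otimes> conj_by G x s \<in> C" if "s \<in> C" for s using subgroup.m_closed[OF C cC Cx[OF that]] .
      show "((\<lambda>n. c x \<otimes> conj_by G x n) ^^ r) s = s" if s: "s \<in> C" for s
      proof -
        have "s \<in> A" using s CA by blast
        then show ?thesis
        using crossed_hom_affine_pow[OF fin J A c xJ, of s r] KJ(2)[OF xr] xr s by (simp add: C_def)
      qed
      show "\<not> r dvd card C"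
        using torsion_group_prime_not_dvd[OF fin C _ q r] tor CA by (auto simp: torsion_group_def)
    qed
    then obtain n where n: "n \<in> C" "c x \<otimes> conj_by G x n = n" by blast
    then have nA: "n \<in> A" using CA by blast
    define c' where "c' = (\<lambda>y. inv n \<otimes> c y \<otimes> conj_by G y n)"
    have c': "crossed_hom G J A c'" unfolding c'_def by (rule crossed_hom_twist[OF fin J A c nA])
    have c'K: "c' k = \<one>" if "k \<in> K" for k
      using that n(1) nA KJ(2)[OF that] unfolding c'_def C_def by simp
    have c'x: "c' x = \<one>" using n nA xJ AA unfolding c'_def by (simp add: m_assoc)
    have "\<exists>m\<in>A. \<forall>x\<in>J. c' x = m \<otimes> inv (conj_by G x m)"
    proof (rule less.hyps[OF _ c'])
      have "K \<subset> {x \<in> J. c' x = \<one>}" using c'K c'x xK xJ KJ(1) by blast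
      moreover have "finite {x \<in> J. c' x = \<one>}" using finJ by simp
      ultimately have "card K < card {x \<in> J. c' x = \<one>}" by (rule psubset_card_mono[rotated])
      moreover have "card {x \<in> J. c' x = \<one>} \<le> card J" using finJ by (intro card_mono) auto
      ultimately show "card J - card {x \<in> J. c' x = \<one>} < card J - card {x \<in> J. c x = \<one>}"
        unfolding K_def by linarith
      show "c' x = \<one>" if "x \<in> Q" for x using c'K that cQ Q(2) by (auto simp: K_def)
      show "c' (conj_by G x y \<otimes> inv y) = \<one>" if "x \<in> J" "y \<in> J" for x y
        using c'K ccomm[OF that] that by (simp add: K_def conj_by_def)
    qed
    then obtain m where m: "m \<in> A" "\<And>x. x \<in> J \<Longrightarrow> c' x = m \<otimes> inv (conj_by G x m)" by blast
    have "c x = (n \<otimes> m) \<otimes> inv (conj_by G x (n \<otimes> m))" if x: "x \<in> J" for x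
      using x nA m AA by (intro principal_if_twist_principal) (auto simp: c'_def)
    then show ?thesis using nA m(1) A.m_closed by blast
  qed
qed

text \<open>
  For a nonabelian \<open>A\<close>, triviality on \<open>Q\<close> is exploited through a normal subgroup \<open>E\<close> that contains
  all commutators and whose elements of order prime to \<open>q\<close> centralize \<open>A\<close>. On such an element \<open>c\<close> is
  multiplicative, hence trivial, because its value is a \<open>q\<close>-element of order prime to \<open>q\<close>. The group
  \<open>D\<close> generated by \<open>Q\<close> and \<open>E \<inter> J\<close> has \<open>Q\<close> as a Sylow \<open>q\<close>-subgroup, and its elements of order prime to \<open>q\<close>
  lie in \<open>E\<close>; by counting, \<open>c\<close> is trivial on \<open>D\<close>, and \<open>D\<close> contains the commutators of \<open>J\<close>.
\<close>
lemma crossed_hom_principal_if_trivial_on_sylow: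
  assumes fin: "finite (carrier G)" and J: "subgroup J G" and A: "A \<lhd> G"
    and q: "Factorial_Ring.prime q" and tor: "torsion_group G q A"
    and Q: "subgroup Q G" "Q \<subseteq> J" "card Q = q ^ multiplicity q (card J)"
    and c: "crossed_hom G J A c" and cQ: "\<And>x. x \<in> Q \<Longrightarrow> c x = \<one>"
    and E: "E \<lhd> G" and comm: "\<And>x y. x \<in> carrier G \<Longrightarrow> y \<in> carrier G \<Longrightarrow> conj_by G x y \<otimes> inv y \<in> E"
    and cent: "\<And>x a r k. x \<in> E \<Longrightarrow> a \<in> A \<Longrightarrow> Factorial_Ring.prime r \<Longrightarrow> r \<noteq> q \<Longrightarrow>
                 x [^] (r ^ k :: nat) = \<one> \<Longrightarrow> conj_by G x a = a"
  shows "\<exists>n\<in>A. \<forall>x\<in>J. c x = n \<otimes> inv (conj_by G x n)"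
proof -
  interpret A: subgroup A G using A by (rule normal_imp_subgroup)
  interpret E: subgroup E G using E by (rule normal_imp_subgroup)
  interpret J: subgroup J G by (rule J)
  interpret Q: subgroup Q G by (rule Q)
  note mult = crossed_hom_mult[OF fin J A c]
  note AA = crossed_hom_mem[OF fin J A c]
  define D where "D = {x \<in> J. \<exists>u\<in>Q. inv u \<otimes> x \<in> E}"
  have DJ: "D \<subseteq> J" by (auto simp: D_def)
  have QD: "Q \<subseteq> D"
  proof
    fix u assume "u \<in> Q"
    moreover from this have "u \<in> J" "inv u \<otimes> u \<in> E" using Q(2) by auto
    ultimately show "u \<in> D" unfolding D_def by blast
  qed
  have step: "inv (u \<otimes> v) \<otimes> (x \<otimes> y) \<in> E"
    if "u \<in> carrier G" "v \<in> carrier G" "x \<in> carrier G" "y \<in> carrier G" "inv u \<otimes> x \<in> E" "inv v \<otimes> y \<in> E" for u v x y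
  proof -
    have "inv (u \<otimes> v) \<otimes> (x \<otimes> y) = conj_by G (inv v) (inv u \<otimes> x) \<otimes> (inv v \<otimes> y)"
      using that(1-4) by (simp add: conj_by_def m_assoc inv_mult_group)
    then show ?thesis using that normal_conj_by[OF E] by simp
  qed
  have D: "subgroup D G"
  proof (rule finite_subgroupI[OF fin])
    show "D \<subseteq> carrier G" using DJ J.subset by blast
    show "\<one> \<in> D" using QD Q.one_closed by blast
    show "x \<otimes> y \<in> D" if xy: "x \<in> D" "y \<in> D" for x y
    proof -
      obtain u v where uv: "u \<in> Q" "inv u \<otimes> x \<in> E" "v \<in> Q" "inv v \<otimes> y \<in> E" using xy by (auto simp: D_def)
      then have "inv (u \<otimes> v) \<otimes> (x \<otimes> y) \<in> E"
        using xy DJ by (intro step) auto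
      then show ?thesis using uv xy by (auto simp: D_def)
    qed
  qed
  interpret D: subgroup D G by (rule D)
  have pow: "inv (u [^] m) \<otimes> x [^] m \<in> E"
    if "u \<in> carrier G" "x \<in> carrier G" "inv u \<otimes> x \<in> E" for u x and m :: nat
    using that by (induction m) (simp_all add: step)
  \<comment> \<open>Modulo \<open>E\<close> the element \<open>x\<close> agrees with an element of \<open>Q\<close>, so its \<open>card Q\<close>-th power lies in \<open>E\<close>.\<close>
  have triv_coprime: "c x = \<one>" if x: "x \<in> D" "Factorial_Ring.prime r" "r \<noteq> q" "x [^] (r ^ k :: nat) = \<one>" for x r k
  proof -
    have xJ: "x \<in> J" using x DJ by blast
    obtain u where u: "u \<in> Q" "inv u \<otimes> x \<in> E" using x(1) by (auto simp: D_def)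
    have "x [^] card Q \<in> E"
      using pow[of u x "card Q"] u xJ pow_card_subgroup[OF Q(1) u(1)] by simp
    moreover have "coprime (card Q) (r ^ k)" using Q(3) q x(2,3) by (simp add: primes_coprime)
    ultimately have xE: "x \<in> E" using coprime_pow_mem[OF E.subgroup_axioms, of x "card Q" "r ^ k"] x(4) xJ by simp
    have fix_a: "conj_by G x a = a" if "a \<in> A" for a using cent[OF xE that x(2-4)] .
    have "conj_by G (x [^] m) a = a" if "a \<in> A" for a and m :: nat
      using that xJ by (induction m) (simp_all add: conj_by_conj_by fix_a)
    then have "c (x [^] m) = c x [^] m" for m :: nat
      using xJ AA[OF xJ] crossed_hom_one[OF fin J A c] subgroup_nat_pow[OF J xJ]
      by (induction m) (simp_all add: mult)
    from this[of "r ^ k"] have "c x [^] (r ^ k) = \<one>" using x(4) crossed_hom_one[OF fin J A c] by simp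
    moreover obtain l where "c x [^] (q ^ l) = \<one>" using tor AA[OF xJ] by (auto simp: torsion_group_def)
    moreover have "coprime (q ^ l) (r ^ k)" using q x(2,3) by (simp add: primes_coprime)
    ultimately show ?thesis using coprime_pow_eq_one[of "c x" "q ^ l" "r ^ k"] AA[OF xJ] by simp
  qed
  define K where "K = D \<inter> {x \<in> J. c x = \<one>}"
  have "K = D"
  proof (rule subgroup_eq_if_contains_sylows[OF fin D _ _ Q(1) _ _ q])
    show "subgroup K G" unfolding K_def
      using D crossed_hom_kernel_subgroup[OF fin J A c] by (rule subgroups_Inter_pair)
    show "Q \<subseteq> K" using QD cQ Q(2) by (auto simp: K_def)
    have nz: "card J \<noteq> 0" "card D \<noteq> 0"
      using fin DJ J.subset J.one_closed D.one_closed finite_subset by (metis card_0_eq empty_iff)+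
    have "\<not> is_unit q" using q by auto
    have "multiplicity q (card J) \<le> multiplicity q (card D)"
      using card_subgroup_dvd[OF Q(1) D QD] Q(3) nz \<open>\<not> is_unit q\<close> by (intro multiplicity_geI) auto
    moreover have "multiplicity q (card D) \<le> multiplicity q (card J)"
      using card_subgroup_dvd[OF D J DJ] nz by (intro dvd_imp_multiplicity_le) auto
    ultimately show "card Q = q ^ multiplicity q (card D)" using Q(3) by simp
    show "x \<in> K" if "x \<in> D" "Factorial_Ring.prime r" "r \<noteq> q" "x [^] (r ^ k :: nat) = \<one>" for x r k
      using triv_coprime[OF that] that(1) DJ by (auto simp: K_def)
  qed (auto simp: K_def)
  then have cD: "c x = \<one>" if "x \<in> D" for x using that by (auto simp: K_def)
  show ?thesis
  proof (rule crossed_hom_principal_if_abelian_mod_kernel[OF fin J A q tor Q c cQ])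
    fix x y assume xy: "x \<in> J" "y \<in> J"
    have "conj_by G x y \<otimes> inv y \<in> J" using xy by (simp add: conj_by_def)
    moreover have "inv \<one> \<otimes> (conj_by G x y \<otimes> inv y) \<in> E" using comm xy by simp
    ultimately have "conj_by G x y \<otimes> inv y \<in> D" using Q.one_closed unfolding D_def by blast
    then show "c (conj_by G x y \<otimes> inv y) = \<one>" by (rule cD)
  qed
qed

section \<open>Commutators in supersoluble groups\<close>

lemma r_coset_eq_one_iff: "A \<lhd> G \<Longrightarrow> x \<in> carrier G \<Longrightarrow> A #> x = A \<longleftrightarrow> x \<in> A"
  by (meson coset_join1 coset_join2 normal_imp_subgroup subgroup.subset)

lemma r_coset_group_hom: "A \<lhd> G \<Longrightarrow> group_hom G (G Mod A) (\<lambda>x. A #> x)"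
  by (simp add: group_hom_def group_hom_axioms_def normal.factorgroup_is_group normal.r_coset_hom_Mod)

lemma group_hom_conj_by:
  assumes "group_hom G H h" "x \<in> carrier G" "y \<in> carrier G"
  shows "h (conj_by G x y) = conj_by H (h x) (h y)"
proof -
  interpret group_hom G H h by (rule assms)
  show ?thesis using assms by (simp add: conj_by_def)
qed

text \<open>
  An automorphism of a cyclic group raises every element to a fixed power, so any two of them
  commute. The two products \<open>g \<otimes> h\<close> and \<open>h \<otimes> g\<close> therefore act in the same way on \<open>B\<close> modulo \<open>A\<close>.
\<close>
lemma commutators_centralize_cyclic_factor:
  assumes A: "A \<lhd> G" and B: "B \<lhd> G" and AB: "A \<subseteq> B"
    and cyc: "cyclic_group (G\<lparr>carrier := B\<rparr> Mod A)"
    and g: "g \<in> carrier G" and h: "h \<in> carrier G" and t: "t \<in> B"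
  shows "conj_by G (conj_by G g h \<otimes> inv h) t \<otimes> inv t \<in> A"
proof -
  interpret B: subgroup B G using B by (rule normal_imp_subgroup)
  interpret p: group_hom G "G Mod A" "\<lambda>x. A #> x" using A by (rule r_coset_group_hom)
  interpret AB: normal A "G\<lparr>carrier := B\<rparr>"
    using normal_restrict_supergroup[OF B.subgroup_axioms A AB] .
  let ?F = "G\<lparr>carrier := B\<rparr> Mod A"
  let ?p = "\<lambda>x. A #> x"
  obtain Y where Y: "Y \<in> carrier ?F" "carrier ?F = range (\<lambda>n::int. Y [^]\<^bsub>?F\<^esub> n)"
    using cyc group.cyclic_group[OF AB.factorgroup_is_group] by blast
  have "Y \<in> ?p ` B" using Y(1) by (simp add: carrier_FactGroup)
  then obtain s where s: "s \<in> B" "Y = ?p s" by blast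
  have gen: "\<exists>k::int. ?p b = ?p s [^]\<^bsub>G Mod A\<^esub> k" if "b \<in> B" for b
  proof -
    have "?p b \<in> carrier ?F" using that by (auto simp: carrier_FactGroup)
    then obtain k :: int where "?p b = Y [^]\<^bsub>?F\<^esub> k" using Y(2) by blast
    also have "\<dots> = ?p (s [^]\<^bsub>G\<lparr>carrier := B\<rparr>\<^esub> k)"
      using AB.FactGroup_int_pow[of s k] s by simp
    also have "\<dots> = ?p s [^]\<^bsub>G Mod A\<^esub> k"
      using s p.hom_int_pow[of s k] int_pow_consistent[OF B.subgroup_axioms s(1)] by simp
    finally show ?thesis by blast
  qed
  let ?M = "G Mod A"
  obtain k l :: int where kl: "conj_by ?M (?p g) (?p s) = ?p s [^]\<^bsub>?M\<^esub> k"
      "conj_by ?M (?p h) (?p s) = ?p s [^]\<^bsub>?M\<^esub> l"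
    using gen[OF normal_conj_by[OF B g s(1)]] gen[OF normal_conj_by[OF B h s(1)]]
      g h s(1) by (auto simp: group_hom_conj_by[OF p.group_hom_axioms])
  have car: "?p g \<in> carrier ?M" "?p h \<in> carrier ?M" "?p s \<in> carrier ?M" using g h s(1) by (auto intro: p.hom_closed)
  note kls = p.H.conj_by_int_pow kl p.H.int_pow_pow p.H.conj_by_conj_by p.H.int_pow_closed
  have comm: "conj_by ?M (?p g \<otimes>\<^bsub>?M\<^esub> ?p h) (?p s [^]\<^bsub>?M\<^esub> m) =
      conj_by ?M (?p h \<otimes>\<^bsub>?M\<^esub> ?p g) (?p s [^]\<^bsub>?M\<^esub> m)" for m :: int
    using car by (simp add: kls mult.commute mult.left_commute del: mult_FactGroup)
  define t' where "t' = conj_by G (inv (h \<otimes> g)) t"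
  have t': "t' \<in> B" "t = conj_by G (h \<otimes> g) t'"
    using t g h normal_conj_by[OF B] by (auto simp: t'_def)
  define w where "w = conj_by G g h \<otimes> inv h"
  have w: "w \<in> carrier G" "w \<otimes> (h \<otimes> g) = g \<otimes> h"
    using g h by (auto simp: w_def conj_by_def m_assoc)
  obtain m :: int where m: "?p t' = ?p s [^]\<^bsub>?M\<^esub> m" using gen[OF t'(1)] by blast
  have "?p (conj_by G w t) = ?p (conj_by G (g \<otimes> h) t')"
    using t' w g h by (simp flip: conj_by_conj_by)
  also have "\<dots> = ?p t"
    using t' g h comm[of m] m by (simp add: group_hom_conj_by[OF p.group_hom_axioms] p.hom_mult del: mult_FactGroup)
  finally have pwt: "?p (conj_by G w t \<otimes> inv t) = A"
    using t w p.hom_mult p.hom_inv p.hom_closed p.H.r_inv[of "?p t"] by (simp del: mult_FactGroup)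
  have "conj_by G w t \<otimes> inv t \<in> carrier G" using t w(1) by simp
  then show ?thesis using r_coset_eq_one_iff[OF A] pwt unfolding w_def by blast
qed

text \<open>
  Take for \<open>E\<close> the elements that act trivially on every factor of the series. An element of \<open>E\<close>
  of order \<open>m\<close> prime to \<open>q\<close> acts on a \<open>q\<close>-group \<open>A\<close> by a map that stabilizes the series; moving up the
  series, \<open>z = conj_by G x a \<otimes> inv a\<close> is already fixed by \<open>x\<close>, so \<open>x [^] k\<close> moves \<open>a\<close> by \<open>z [^] k\<close>, and
  \<open>k = m\<close> gives \<open>z [^] m = \<one>\<close>, that is, \<open>z = \<one>\<close>. This is the only place where supersolubility
  enters.
\<close>
lemma supersoluble_commutators_act_nearly_trivially:
  assumes fin: "finite (carrier G)" and "supersoluble G"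
  shows "\<exists>E. E \<lhd> G \<and> (\<forall>x\<in>carrier G. \<forall>y\<in>carrier G. conj_by G x y \<otimes> inv y \<in> E) \<and>
    (\<forall>A q m. \<forall>x\<in>E. \<forall>a\<in>A. A \<lhd> G \<longrightarrow> torsion_group G q A \<longrightarrow> coprime m q \<longrightarrow>
       x [^] (m::nat) = \<one> \<longrightarrow> conj_by G x a = a)"
proof -
  obtain n :: nat and S where *: "S 0 = {\<one>} \<and> S n = carrier G \<and> (\<forall>i\<le>n. S i \<lhd> G) \<and>
    (\<forall>i<n. S i \<subseteq> S (Suc i) \<and> cyclic_group (G\<lparr>carrier := S (Suc i)\<rparr> Mod S i))"
    using assms unfolding supersoluble_def by (elim exE) (rule that)
  have S: "S 0 = {\<one>}" "S n = carrier G" "\<And>i. i \<le> n \<Longrightarrow> S i \<lhd> G"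
    "\<And>i. i < n \<Longrightarrow> S i \<subseteq> S (Suc i)" "\<And>i. i < n \<Longrightarrow> cyclic_group (G\<lparr>carrier := S (Suc i)\<rparr> Mod S i)"
    using * by simp_all
  have S_carrier: "t \<in> carrier G" if "t \<in> S i" "i \<le> n" for i t
    using subgroup.mem_carrier[OF normal_imp_subgroup[OF S(3)[OF that(2)]] that(1)] .
  define E where "E = {y \<in> carrier G. \<forall>i<n. \<forall>t\<in>S (Suc i). conj_by G y t \<otimes> inv t \<in> S i}"
  have "subgroup E G"
  proof (rule finite_subgroupI[OF fin])
    show "E \<subseteq> carrier G" by (auto simp: E_def)
    have "\<one> \<in> S i" if "i < n" for i
      using subgroup.one_closed[OF normal_imp_subgroup[OF S(3)]] that by simp
    moreover have "conj_by G \<one> t \<otimes> inv t = \<one>" if "i < n" "t \<in> S (Suc i)" for i t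
      using S_carrier[OF that(2)] that(1) by simp
    ultimately show "\<one> \<in> E" by (simp add: E_def)
    fix y assume y: "y \<in> E"
    fix z assume z: "z \<in> E"
    show "y \<otimes> z \<in> E"
      unfolding E_def
    proof (intro CollectI conjI allI impI ballI)
      show "y \<otimes> z \<in> carrier G" using y z by (auto simp: E_def)
      fix i t assume i: "i < n" and t: "t \<in> S (Suc i)"
      have yG: "y \<in> carrier G" "z \<in> carrier G" and tG: "t \<in> carrier G" using y z t S_carrier[OF t] i by (auto simp: E_def)
      have "conj_by G y (conj_by G z t \<otimes> inv t) \<in> S i"
        using y z i t by (intro normal_conj_by S(3)) (auto simp: E_def)
      moreover have "conj_by G y t \<otimes> inv t \<in> S i" using y i t by (auto simp: E_def)
      ultimately have "conj_by G y (conj_by G z t \<otimes> inv t) \<otimes> (conj_by G y t \<otimes> inv t) \<in> S i"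
        using subgroup.m_closed[OF normal_imp_subgroup[OF S(3)]] i by simp
      then show "conj_by G (y \<otimes> z) t \<otimes> inv t \<in> S i"
        using yG tG by (simp add: conj_by_mult conj_by_inv conj_by_conj_by m_assoc)
    qed
  qed
  moreover have "conj_by G g y \<in> E" if g: "g \<in> carrier G" and y: "y \<in> E" for g y
    unfolding E_def
  proof (intro CollectI conjI allI impI ballI)
    show "conj_by G g y \<in> carrier G" using g y by (auto simp: E_def)
    fix i t assume i: "i < n" and t: "t \<in> S (Suc i)"
    have yG: "y \<in> carrier G" and tG: "t \<in> carrier G" using y t S_carrier[OF t] i by (auto simp: E_def)
    define t' where "t' = conj_by G (inv g) t"
    have t': "t' \<in> S (Suc i)" "t' \<in> carrier G" using t g tG i S(3)[of "Suc i"] by (auto simp: t'_def normal_conj_by)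
    have "t = conj_by G g t'" using g tG by (simp add: t'_def)
    moreover have "conj_by G (conj_by G g y) (conj_by G g t') = conj_by G g (conj_by G y t')"
      using g yG t' by (simp add: conj_by_def m_assoc inv_mult_group)
    ultimately have "conj_by G (conj_by G g y) t \<otimes> inv t = conj_by G g (conj_by G y t' \<otimes> inv t')"
      using g yG t' by (simp add: conj_by_mult conj_by_inv)
    also have "\<dots> \<in> S i" using y i t' g by (intro normal_conj_by S(3)) (auto simp: E_def)
    finally show "conj_by G (conj_by G g y) t \<otimes> inv t \<in> S i" .
  qed
  ultimately have "E \<lhd> G" by (rule normalI_conj_by)
  moreover have "conj_by G x y \<otimes> inv y \<in> E" if "x \<in> carrier G" "y \<in> carrier G" for x y
    using that commutators_centralize_cyclic_factor[OF S(3) S(3) S(4) S(5) that]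
    by (simp add: E_def conj_by_def Suc_le_eq)
  moreover have "conj_by G x a = a"
    if A: "A \<lhd> G" "torsion_group G q A" "coprime m q" and x: "x \<in> E" "x [^] (m::nat) = \<one>" and a: "a \<in> A"
    for A q m x a
  proof -
    have xG: "x \<in> carrier G" using x by (simp add: E_def)
    interpret A: subgroup A G using A(1) by (rule normal_imp_subgroup)
    have "conj_by G x a = a" if "i \<le> n" "a \<in> S i" "a \<in> A" for i a
      using that
    proof (induction i arbitrary: a)
      case 0
      then show ?case using S(1) xG by simp
    next
      case (Suc i)
      define z where "z = conj_by G x a \<otimes> inv a"
      have aG: "a \<in> carrier G" using A.mem_carrier[OF Suc.prems(3)] .
      have zA: "z \<in> A" using Suc.prems xG by (simp add: z_def normal_conj_by[OF A(1)])
      have "z \<in> S i" using Suc.prems x by (auto simp: E_def z_def)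
      then have xz: "conj_by G x z = z" using Suc zA by simp
      have xa: "conj_by G x a = z \<otimes> a" using xG aG by (simp add: z_def m_assoc)
      have "conj_by G (x [^] k) a = z [^] k \<otimes> a" for k :: nat
      proof (induction k)
        case (Suc k)
        have "conj_by G (x [^] Suc k) a = conj_by G x (conj_by G (x [^] k) a)"
          using xG aG nat_pow_Suc2[OF xG] by (simp add: conj_by_conj_by)
        also have "\<dots> = z [^] k \<otimes> (z \<otimes> a)"
          using Suc xG aG zA by (simp add: conj_by_mult conj_by_nat_pow xz xa)
        finally show ?case using zA aG by (simp add: m_assoc)
      qed (use aG in simp)
      from this[of m] have "z [^] m = \<one>" using x(2) aG zA by simp
      moreover obtain k where "z [^] (q ^ k) = \<one>" using A(2) zA by (auto simp: torsion_group_def)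
      ultimately have "z = \<one>" using coprime_pow_eq_one[of z m "q ^ k"] A(3) zA by simp
      then show ?case using xa aG by simp
    qed
    from this[of n] show ?thesis using a S(2) by auto
  qed
  ultimately show ?thesis by (intro exI[of _ E] conjI ballI allI impI)
qed

section \<open>Primary decomposition of nilpotent groups\<close>

text \<open>
  Call an element torsion if some power \<open>b ^ k\<close> annihilates it, and let \<open>H\<close> be a maximal subgroup
  consisting of torsion elements. A torsion element \<open>y\<close> that
  normalizes \<open>H\<close> lies in \<open>H\<close>, because \<open>H\<close> and \<open>y\<close> together generate a group of torsion elements.
  Going up the central series \<open>Z\<close>, every torsion element of \<open>H <#> Z i\<close> lies in \<open>H\<close>: a torsion element
  of \<open>H <#> Z (Suc i)\<close> conjugates \<open>H\<close> into the torsion elements of \<open>H <#> Z i\<close>, hence into \<open>H\<close>, and so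
  normalizes \<open>H\<close>. At the top of the series \<open>H\<close> contains every torsion element.
\<close>
lemma nilpotent_torsion_subgroup:
  assumes fin: "finite (carrier G)" and nil: "nilpotent_group G"
  shows "subgroup (torsion_part G b (carrier G)) G"
proof -
  obtain n :: nat and Z where *: "Z 0 = {\<one>} \<and> Z n = carrier G \<and> (\<forall>i\<le>n. Z i \<lhd> G) \<and>
       (\<forall>i<n. Z i \<subseteq> Z (Suc i) \<and> carrier (G\<lparr>carrier := Z (Suc i)\<rparr> Mod Z i) \<subseteq> center (G Mod Z i))"
    using nil unfolding nilpotent_group_def by (elim exE) (rule that)
  then have Z: "Z 0 = {\<one>}" "Z n = carrier G" "\<And>i. i \<le> n \<Longrightarrow> Z i \<lhd> G"
    and cen: "\<And>i. i < n \<Longrightarrow> carrier (G\<lparr>carrier := Z (Suc i)\<rparr> Mod Z i) \<subseteq> center (G Mod Z i)"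
    by simp_all
  have Z_carrier: "z \<in> carrier G" if "z \<in> Z i" "i \<le> n" for i z
    using subgroup.mem_carrier[OF normal_imp_subgroup[OF Z(3)[OF that(2)]] that(1)] .
  have central: "conj_by G z x \<otimes> inv x \<in> Z i" if i: "i < n" and z: "z \<in> Z (Suc i)" and x: "x \<in> carrier G" for i z x
  proof -
    have zG: "z \<in> carrier G" using Z_carrier[OF z] i by simp
    have Zi: "Z i \<lhd> G" using Z(3) i by simp
    interpret p: group_hom G "G Mod Z i" "\<lambda>x. Z i #> x" using r_coset_group_hom[OF Zi] .
    have "Z i #> z \<in> carrier (G\<lparr>carrier := Z (Suc i)\<rparr> Mod Z i)"
      using z by (simp add: carrier_FactGroup)
    then have "Z i #> z \<in> center (G Mod Z i)" using cen[OF i] by blast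
    then have "(Z i #> z) \<otimes>\<^bsub>G Mod Z i\<^esub> (Z i #> x) = (Z i #> x) \<otimes>\<^bsub>G Mod Z i\<^esub> (Z i #> z)"
      using x p.hom_closed unfolding center_def by blast
    then have "Z i #> (z \<otimes> x) = Z i #> (x \<otimes> z)"
      using zG x by (simp add: p.hom_mult del: mult_FactGroup)
    then have "Z i #> ((z \<otimes> x) \<otimes> inv (x \<otimes> z)) = Z i"
      using zG x p.hom_mult[of "z \<otimes> x" "inv (x \<otimes> z)"] p.hom_mult[of "x \<otimes> z" "inv (x \<otimes> z)"] p.hom_one
      by (simp del: mult_FactGroup)
    moreover have "(z \<otimes> x) \<otimes> inv (x \<otimes> z) \<in> carrier G" using zG x by simp
    ultimately have "(z \<otimes> x) \<otimes> inv (x \<otimes> z) \<in> Z i" using r_coset_eq_one_iff[OF Zi] by blast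
    then show ?thesis using zG x by (simp add: conj_by_def m_assoc inv_mult_group)
  qed
  define T where "T = torsion_part G b (carrier G)"
  define F where "F = {H. subgroup H G \<and> H \<subseteq> T}"
  have "F \<subseteq> Pow (carrier G)" by (auto simp: F_def T_def torsion_part_def)
  then have finF: "finite F" using fin finite_subset by blast
  have "{\<one>} \<in> F" using triv_subgroup by (simp add: F_def T_def torsion_part_def)
  then obtain H where "H \<in> F" and max: "\<And>H'. H' \<in> F \<Longrightarrow> H \<subseteq> H' \<Longrightarrow> H' = H"
    using finite_has_maximal[OF finF] by blast
  then have H: "subgroup H G" and HT: "H \<subseteq> T" by (auto simp: F_def)
  interpret H: subgroup H G by (rule H)
  have conj_T: "conj_by G g x \<in> T" if "g \<in> carrier G" "x \<in> T" for g x
    using that by (auto simp: T_def torsion_part_def) (metis conj_by_nat_pow conj_by_one(2))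
  have mem: "y \<in> H" if yT: "y \<in> T" and y_norm: "\<And>x. x \<in> H \<Longrightarrow> conj_by G y x \<in> H" for y
  proof -
    have yG: "y \<in> carrier G" using yT by (simp add: T_def torsion_part_def)
    obtain j where j: "y [^] (b ^ j :: nat) = \<one>" using yT by (auto simp: T_def torsion_part_def)
    have conj_pow: "conj_by G (y [^] k) x \<in> H" if "x \<in> H" for x and k :: nat
      using that yG by (induction k arbitrary: x) (simp_all add: conj_by_conj_by y_norm)
    have prod: "(h \<otimes> y [^] k) \<otimes> (h' \<otimes> y [^] l) = (h \<otimes> conj_by G (y [^] k) h') \<otimes> y [^] (k + l)"
      if "h \<in> H" "h' \<in> H" for h h' and k l :: nat
      using that yG by (simp add: conj_by_def m_assoc flip: nat_pow_mult)
    define H' where "H' = {h \<otimes> y [^] k | h k. h \<in> H \<and> (k::nat) \<in> UNIV}"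
    have H'I: "h \<otimes> y [^] k \<in> H'" if "h \<in> H" for h and k :: nat
      using that by (auto simp: H'_def)
    have "subgroup H' G"
    proof (rule finite_subgroupI[OF fin])
      show "H' \<subseteq> carrier G" using yG by (auto simp: H'_def)
      show "\<one> \<in> H'" using H'I[OF H.one_closed, of 0] by simp
      show "u \<otimes> v \<in> H'" if "u \<in> H'" "v \<in> H'" for u v
        using that prod conj_pow H'I by (auto simp: H'_def)
    qed
    moreover have "H' \<subseteq> T"
    proof
      fix u assume "u \<in> H'"
      then obtain h k where u: "h \<in> H" "u = h \<otimes> y [^] (k::nat)" by (auto simp: H'_def)
      then have uG: "u \<in> carrier G" using yG by simp
      have "\<exists>h'\<in>H. u [^] m = h' \<otimes> y [^] (k * m)" for m :: nat
      proof (induction m)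
        case (Suc m)
        then obtain h' where h': "h' \<in> H" "u [^] m = h' \<otimes> y [^] (k * m)" by blast
        then have "u [^] Suc m = (h' \<otimes> conj_by G (y [^] (k * m)) h) \<otimes> y [^] (k * m + k)"
          using prod[OF h'(1) u(1), of "k * m" k] u(2) by simp
        then show ?case using h' u conj_pow by (intro bexI[of _ "h' \<otimes> conj_by G (y [^] (k * m)) h"]) (simp_all add: add.commute)
      qed (intro bexI[of _ \<one>], simp_all)
      then obtain h' where "h' \<in> H" "u [^] (b ^ j) = h' \<otimes> y [^] (k * b ^ j)" by blast
      moreover have "y [^] (k * b ^ j) = \<one>" using yG j by (metis mult.commute nat_pow_one nat_pow_pow)
      ultimately have "u [^] (b ^ j) \<in> H" by simp
      then obtain l where "(u [^] (b ^ j)) [^] (b ^ l :: nat) = \<one>" using HT by (auto simp: T_def torsion_part_def)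
      then have "u [^] (b ^ (j + l)) = \<one>" using uG by (simp add: nat_pow_pow power_add)
      then show "u \<in> T" using uG by (auto simp: T_def torsion_part_def)
    qed
    moreover have "H \<subseteq> H'" using H'I[of _ 0] by auto
    ultimately have "H' = H" using max by (simp add: F_def)
    then show ?thesis using H'I[OF H.one_closed, of 1] yG by simp
  qed
  have "h \<otimes> z \<in> H" if "i \<le> n" "h \<in> H" "z \<in> Z i" "h \<otimes> z \<in> T" for i h z
    using that
  proof (induction i arbitrary: h z)
    case 0
    then show ?case using Z(1) by simp
  next
    case (Suc i)
    have i: "i < n" using Suc.prems by simp
    have zG: "z \<in> carrier G" using Z_carrier Suc.prems by blast
    show ?case
    proof (rule mem[OF Suc.prems(4)])
      fix x assume x: "x \<in> H"
      define a where "a = conj_by G z x \<otimes> inv x"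
      have a: "a \<in> Z i" using central[OF i Suc.prems(3)] x unfolding a_def by simp
      have "conj_by G (h \<otimes> z) x = conj_by G h x \<otimes> conj_by G (h \<otimes> inv x) a"
        using x Suc.prems(2) zG by (simp add: a_def conj_by_def m_assoc inv_mult_group)
      moreover have "conj_by G (h \<otimes> z) x \<in> T"
        using x Suc.prems(2) zG HT by (intro conj_T) auto
      moreover have "conj_by G h x \<in> H" using x Suc.prems(2) by (simp add: conj_by_def)
      moreover have "conj_by G (h \<otimes> inv x) a \<in> Z i"
        using Z(3) i x Suc.prems(2) a by (intro normal_conj_by) auto
      ultimately show "conj_by G (h \<otimes> z) x \<in> H" using Suc.IH i by simp
    qed
  qed
  from this[of n \<one>] have "T \<subseteq> H" using Z(2) by (auto simp: T_def torsion_part_def)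
  then have "T = H" using HT by blast
  then show ?thesis using H by (simp add: T_def)
qed

text \<open>
  A finite nilpotent group is the direct product of its \<open>a\<close>-torsion and \<open>b\<close>-torsion elements. The
  exponent \<open>b * u = a * v + 1\<close> is an idempotent modulo the group order, and raising to it is the
  projection to the \<open>a\<close>-torsion factor. A projection given by a power map commutes with conjugation,
  which is why the direct product itself never has to be named.
\<close>
lemma nilpotent_pow_mult_distrib:
  assumes fin: "finite (carrier G)" and nil: "nilpotent_group G"
    and ord: "order G = a * b" and cop: "coprime a b" and e: "b * u = a * v + 1"
    and xy: "x \<in> carrier G" "y \<in> carrier G"
  shows "(x \<otimes> y) [^] (b * u) = x [^] (b * u) \<otimes> y [^] (b * u :: nat)"
proof -
  define T where "T = (\<lambda>m. torsion_part G m (carrier G))"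
  have T: "subgroup (T m) G" for m unfolding T_def by (rule nilpotent_torsion_subgroup[OF fin nil])
  have Tc: "x \<in> carrier G" if "x \<in> T m" for x m using that by (simp add: T_def torsion_part_def)
  have T_norm: "conj_by G g x \<in> T m" if "g \<in> carrier G" "x \<in> T m" for g x m
    using that by (auto simp: T_def torsion_part_def) (metis conj_by_nat_pow conj_by_one(2))
  have pow_ab: "x [^] (a * b) = \<one>" if "x \<in> carrier G" for x
    using pow_order_eq_1[OF that] ord by simp
  have T_pow: "x [^] m = \<one>" if x: "x \<in> T m" and m: "m * m' = a * b" "coprime m m'" for x m m'
  proof -
    have xG: "x \<in> carrier G" using Tc[OF x] .
    obtain k where k: "x [^] (m ^ k) = \<one>" using x by (auto simp: T_def torsion_part_def)
    have "(x [^] m) [^] m' = \<one>" using pow_ab[OF xG] m xG by (simp add: nat_pow_pow)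
    moreover have "(x [^] m) [^] (m ^ k) = \<one>"
      using xG k by (metis mult.commute nat_pow_one nat_pow_pow)
    ultimately show ?thesis
      using coprime_pow_eq_one[of "x [^] m" m' "m ^ k"] m(2) xG by (simp add: coprime_commute)
  qed
  have T_pow_a: "x [^] a = \<one>" if "x \<in> T a" for x
    using T_pow[OF that refl cop] .
  have T_pow_b: "x [^] b = \<one>" if "x \<in> T b" for x
    using T_pow[OF that, of a] cop by (simp add: mult.commute coprime_commute)
  have comm: "\<alpha> \<otimes> \<beta> = \<beta> \<otimes> \<alpha>" if \<alpha>: "\<alpha> \<in> T a" and \<beta>: "\<beta> \<in> T b" for \<alpha> \<beta>
  proof -
    have c: "\<alpha> \<in> carrier G" "\<beta> \<in> carrier G" using that Tc by blast+
    have "conj_by G \<alpha> \<beta> \<otimes> inv \<beta> \<in> T b"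
      using T_norm[OF c(1) \<beta>] \<beta> subgroup.m_closed[OF T] subgroup.m_inv_closed[OF T] by blast
    moreover have "\<alpha> \<otimes> conj_by G \<beta> (inv \<alpha>) \<in> T a"
      using T_norm[OF c(2) subgroup.m_inv_closed[OF T \<alpha>]] \<alpha> subgroup.m_closed[OF T] by blast
    moreover have "\<alpha> \<otimes> conj_by G \<beta> (inv \<alpha>) = conj_by G \<alpha> \<beta> \<otimes> inv \<beta>"
      using c by (simp add: conj_by_def m_assoc)
    ultimately have w: "conj_by G \<alpha> \<beta> \<otimes> inv \<beta> \<in> T a" "conj_by G \<alpha> \<beta> \<otimes> inv \<beta> \<in> T b" by simp_all
    have "conj_by G \<alpha> \<beta> \<otimes> inv \<beta> = \<one>"
      using coprime_pow_eq_one[OF Tc[OF w(1)] T_pow_a[OF w(1)] T_pow_b[OF w(2)] cop] .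
    then have "conj_by G \<alpha> \<beta> = \<beta>" using c inv_solve_right'[of \<one> "conj_by G \<alpha> \<beta>" \<beta>] by simp
    then show ?thesis using c by (simp add: conj_by_eq_self_iff)
  qed
  have pow_Ta: "\<alpha> [^] (b * u) = \<alpha>" if "\<alpha> \<in> T a" for \<alpha>
    using T_pow_a[OF that] Tc[OF that] unfolding e by (simp flip: nat_pow_mult nat_pow_pow)
  have pow_Tb: "\<beta> [^] (b * u) = \<one>" if "\<beta> \<in> T b" for \<beta>
    using T_pow_b[OF that] Tc[OF that] by (simp flip: nat_pow_pow)
  have split: "\<exists>\<alpha>\<in>T a. \<exists>\<beta>\<in>T b. x = \<alpha> \<otimes> \<beta>" if x: "x \<in> carrier G" for x
  proof -
    have "(x [^] (b * u)) [^] (a ^ 1) = (x [^] (a * b)) [^] u" "(x [^] (a * v)) [^] (b ^ 1) = (x [^] (a * b)) [^] v"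
      using x by (simp_all add: nat_pow_pow ac_simps)
    then have "x [^] (b * u) \<in> T a" and bT: "x [^] (a * v) \<in> T b"
      using x unfolding T_def torsion_part_def pow_ab[OF x] by (auto intro: exI[of _ 1])
    moreover have "inv (x [^] (a * v)) \<in> T b" using subgroup.m_inv_closed[OF T bT] .
    moreover have "x = x [^] (b * u) \<otimes> inv (x [^] (a * v))"
    proof -
      have "x [^] (b * u) = x \<otimes> x [^] (a * v)" unfolding e using x nat_pow_Suc2[OF x] by simp
      then show ?thesis using x by (simp add: m_assoc)
    qed
    ultimately show ?thesis by blast
  qed
  obtain \<alpha> \<beta> \<alpha>' \<beta>' where ab: "\<alpha> \<in> T a" "\<beta> \<in> T b" "x = \<alpha> \<otimes> \<beta>" "\<alpha>' \<in> T a" "\<beta>' \<in> T b" "y = \<alpha>' \<otimes> \<beta>'"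
    using split[OF xy(1)] split[OF xy(2)] by blast
  note abc = ab(1,2,4,5)[THEN Tc]
  have pow: "(\<alpha> \<otimes> \<beta>) [^] (b * u) = \<alpha>" if "\<alpha> \<in> T a" "\<beta> \<in> T b" for \<alpha> \<beta>
    using pow_mult_distrib[OF comm[OF that] Tc[OF that(1)] Tc[OF that(2)], of "b * u"] pow_Ta pow_Tb that Tc
    by simp
  have "x \<otimes> y = (\<alpha> \<otimes> \<alpha>') \<otimes> (\<beta> \<otimes> \<beta>')"
    using ab abc comm[OF ab(4) ab(2)] by (metis m_assoc m_closed)
  then show ?thesis using pow ab subgroup.m_closed[OF T] by simp
qed

text \<open>
  The projection of \<open>N\<close> to its \<open>q\<close>-part, as a power map. The \<open>q\<close>-part is normal in all of \<open>G\<close>, as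
  conjugation preserves orders of elements.
\<close>
lemma nilpotent_normal_primary_power:
  assumes fin: "finite (carrier G)" and N: "N \<lhd> G" and nil: "nilpotent_group (G\<lparr>carrier := N\<rparr>)"
    and q: "Factorial_Ring.prime q"
  shows "\<exists>e::nat. torsion_part G q N \<lhd> G \<and>
    (\<forall>x\<in>N. \<forall>y\<in>N. (x \<otimes> y) [^] e = x [^] e \<otimes> y [^] e) \<and>
    (\<forall>x\<in>N. x [^] e \<in> torsion_part G q N) \<and>
    (\<forall>x\<in>torsion_part G q N. x [^] e = x)"
proof -
  interpret N: subgroup N G using N by (rule normal_imp_subgroup)
  interpret M: group "G\<lparr>carrier := N\<rparr>" using N.subgroup_is_group is_group .
  let ?A = "{x \<in> N. \<exists>k::nat. x [^] (q ^ k :: nat) = \<one>}"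
  have finN: "finite N" using fin N.subset finite_subset by blast
  have pow: "x [^]\<^bsub>G\<lparr>carrier := N\<rparr>\<^esub> k = x [^] k" for x and k :: nat
    by (rule nat_pow_consistent[symmetric])
  have "subgroup ?A (G\<lparr>carrier := N\<rparr>)"
    using M.nilpotent_torsion_subgroup[of q] nil finN by (simp add: pow torsion_part_def)
  then have "subgroup ?A G" using incl_subgroup[OF N.subgroup_axioms] by blast
  moreover have "conj_by G g x \<in> ?A" if "g \<in> carrier G" "x \<in> ?A" for g x
    using that normal_conj_by[OF N] by auto (metis N.mem_carrier conj_by_nat_pow conj_by_one(2))
  ultimately have A: "?A \<lhd> G" by (rule normalI_conj_by)
  define a where "a = q ^ multiplicity q (card N)"
  have "a dvd card N" unfolding a_def by (rule multiplicity_dvd)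
  then obtain b where ab: "card N = a * b" by blast
  have nz: "card N \<noteq> 0" using N.finite_imp_card_positive[OF fin] by simp
  have "\<not> q dvd b"
  proof
    assume "q dvd b"
    then have "a * q dvd card N" unfolding ab by (rule mult_dvd_mono[OF dvd_refl])
    then have "q ^ Suc (multiplicity q (card N)) dvd card N" by (simp add: a_def mult.commute)
    then have "Suc (multiplicity q (card N)) \<le> multiplicity q (card N)"
      using nz q by (intro multiplicity_geI) auto
    then show False by simp
  qed
  then have cop: "coprime a b" unfolding a_def using q by (simp add: prime_imp_coprime)
  have "b \<noteq> 0" using nz ab by auto
  then obtain u v where e: "b * u = a * v + 1"
    using bezout_nat[of b a] cop by (auto simp: coprime_iff_gcd_eq_1 gcd.commute)
  have pow_card: "x [^] (a * b) = \<one>" if "x \<in> N" for x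
    using pow_card_subgroup[OF N.subgroup_axioms that] ab by simp
  show ?thesis
    unfolding torsion_part_def
  proof (intro exI[of _ "b * u"] conjI ballI A)
    show "(x \<otimes> y) [^] (b * u) = x [^] (b * u) \<otimes> y [^] (b * u)" if "x \<in> N" "y \<in> N" for x y
      using M.nilpotent_pow_mult_distrib[OF _ nil _ cop e, of x y] that finN ab
      by (simp add: order_def pow)
    show "x [^] (b * u) \<in> ?A" if x: "x \<in> N" for x
    proof -
      have "(x [^] (b * u)) [^] a = (x [^] (a * b)) [^] u"
        using x by (simp add: nat_pow_pow ac_simps)
      then show ?thesis using x pow_card[OF x] subgroup_nat_pow[OF N.subgroup_axioms x]
        by (auto simp: a_def)
    qed
    show "x [^] (b * u) = x" if x: "x \<in> ?A" for x
    proof -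
      have xN: "x \<in> N" using x by simp
      obtain k where k: "x [^] (q ^ k) = \<one>" using x by blast
      have "(x [^] a) [^] b = \<one>" using pow_card[OF xN] xN by (simp add: nat_pow_pow)
      moreover have "(x [^] a) [^] (q ^ k) = \<one>" using xN k by (metis N.mem_carrier mult.commute nat_pow_one nat_pow_pow)
      moreover have "coprime b (q ^ k)" using prime_imp_coprime[OF q \<open>\<not> q dvd b\<close>] by (simp add: coprime_commute)
      ultimately have "x [^] a = \<one>" using coprime_pow_eq_one[of "x [^] a" b "q ^ k"] xN by simp
      then show ?thesis unfolding e using xN by (simp flip: nat_pow_mult nat_pow_pow)
    qed
  qed
qed

section \<open>Complements and the local-global principle\<close>

text \<open>
  Raising to the power \<open>e q\<close>, for each prime \<open>q\<close>, splits \<open>c\<close> into crossed homomorphisms with values in the Sylow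
  \<open>q\<close>-subgroups \<open>A q\<close> of \<open>N\<close>. Each of them becomes trivial on a Sylow \<open>q\<close>-subgroup of \<open>J\<close> after a twist,
  and so is principal, given by some \<open>\<nu> q\<close>. An element \<open>n\<close> of \<open>N\<close> whose \<open>q\<close>-part is \<open>\<nu> q\<close> for every
  prime divisor \<open>q\<close> of \<open>card N\<close> then works for \<open>c\<close>.
\<close>
lemma crossed_hom_principal_if_locally_principal:
  assumes fin: "finite (carrier G)" and ss: "supersoluble G" and J: "subgroup J G"
    and N: "N \<lhd> G" and nil: "nilpotent_group (G\<lparr>carrier := N\<rparr>)" and c: "crossed_hom G J N c"
    and loc: "\<And>q. Factorial_Ring.prime q \<Longrightarrow> \<exists>Q n. subgroup Q G \<and> Q \<subseteq> J \<and>
      card Q = q ^ multiplicity q (card J) \<and> n \<in> N \<and> (\<forall>x\<in>Q. c x = n \<otimes> inv (conj_by G x n))"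
  shows "\<exists>n\<in>N. \<forall>x\<in>J. c x = n \<otimes> inv (conj_by G x n)"
proof -
  interpret N: subgroup N G using N by (rule normal_imp_subgroup)
  interpret J: subgroup J G by (rule J)
  define A where "A = (\<lambda>q. torsion_part G q N)"
  have AN: "A q \<subseteq> N" for q by (auto simp: A_def torsion_part_def)
  obtain E where E: "E \<lhd> G \<and> (\<forall>x\<in>carrier G. \<forall>y\<in>carrier G. conj_by G x y \<otimes> inv y \<in> E) \<and>
    (\<forall>A q m. \<forall>x\<in>E. \<forall>a\<in>A. A \<lhd> G \<longrightarrow> torsion_group G q A \<longrightarrow> coprime m q \<longrightarrow>
       x [^] (m::nat) = \<one> \<longrightarrow> conj_by G x a = a)"
    using supersoluble_commutators_act_nearly_trivially[OF fin ss] by (rule exE)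
  have E_cent: "conj_by G x a = a" if "B \<lhd> G" "torsion_group G q B" "coprime m q" "x \<in> E" "a \<in> B"
      "x [^] (m::nat) = \<one>" for B q m x a
    using E that by (elim conjE) simp
  have "\<forall>q. \<exists>e::nat. Factorial_Ring.prime q \<longrightarrow> A q \<lhd> G \<and>
      (\<forall>x\<in>N. \<forall>y\<in>N. (x \<otimes> y) [^] e = x [^] e \<otimes> y [^] e) \<and>
      (\<forall>x\<in>N. x [^] e \<in> A q) \<and> (\<forall>x\<in>A q. x [^] e = x)"
    using nilpotent_normal_primary_power[OF fin N nil] unfolding A_def by blast
  from choice[OF this] obtain e :: "nat \<Rightarrow> nat" where
    "\<forall>q. Factorial_Ring.prime q \<longrightarrow> A q \<lhd> G \<and>
      (\<forall>x\<in>N. \<forall>y\<in>N. (x \<otimes> y) [^] e q = x [^] e q \<otimes> y [^] e q) \<and>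
      (\<forall>x\<in>N. x [^] e q \<in> A q) \<and> (\<forall>x\<in>A q. x [^] e q = x)" ..
  then have e: "\<And>q. Factorial_Ring.prime q \<Longrightarrow> A q \<lhd> G"
    "\<And>q x y. Factorial_Ring.prime q \<Longrightarrow> x \<in> N \<Longrightarrow> y \<in> N \<Longrightarrow> (x \<otimes> y) [^] e q = x [^] e q \<otimes> y [^] e q"
    "\<And>q x. Factorial_Ring.prime q \<Longrightarrow> x \<in> N \<Longrightarrow> x [^] e q \<in> A q"
    "\<And>q x. Factorial_Ring.prime q \<Longrightarrow> x \<in> A q \<Longrightarrow> x [^] e q = x"
    by simp_all
  have e_inv: "(inv x) [^] k = inv (x [^] k)" if "x \<in> N" for x and k :: nat
    using that nat_pow_inv by simp
  have e_delta: "(n \<otimes> inv (conj_by G x n)) [^] e q = n [^] e q \<otimes> inv (conj_by G x (n [^] e q))"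
    if "Factorial_Ring.prime q" "n \<in> N" "x \<in> J" for q n x
    using that normal_conj_by[OF N] by (simp add: e(2) e_inv conj_by_nat_pow)
  have cN: "c x \<in> N" if "x \<in> J" for x using c that by (auto simp: crossed_hom_def)
  have part: "\<exists>n\<in>A q. \<forall>x\<in>J. c x [^] e q = n \<otimes> inv (conj_by G x n)" if q: "Factorial_Ring.prime q" for q
  proof -
    interpret A: subgroup "A q" G using e(1)[OF q] by (rule normal_imp_subgroup)
    obtain Q n where Q: "subgroup Q G" "Q \<subseteq> J" "card Q = q ^ multiplicity q (card J)" and n: "n \<in> N"
      and cQ: "\<And>x. x \<in> Q \<Longrightarrow> c x = n \<otimes> inv (conj_by G x n)" using loc[OF q] by blast
    have cq: "crossed_hom G J (A q) (\<lambda>x. c x [^] e q)"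
      using c cN normal_conj_by[OF N] unfolding crossed_hom_def
      by (auto simp: e(2,3)[OF q] conj_by_nat_pow)
    define n' where "n' = n [^] e q"
    have n': "n' \<in> A q" using e(3)[OF q n] by (simp add: n'_def)
    define c' where "c' = (\<lambda>x. inv n' \<otimes> c x [^] e q \<otimes> conj_by G x n')"
    have c': "crossed_hom G J (A q) c'"
      unfolding c'_def using crossed_hom_twist[OF fin J e(1)[OF q] cq n'] .
    have tor: "torsion_group G q (A q)" by (auto simp: torsion_group_def A_def torsion_part_def)
    have "\<exists>m\<in>A q. \<forall>x\<in>J. c' x = m \<otimes> inv (conj_by G x m)"
    proof (rule crossed_hom_principal_if_trivial_on_sylow[OF fin J e(1)[OF q] q tor Q c'])
      fix x assume x: "x \<in> Q"
      then have "c x [^] e q = n' \<otimes> inv (conj_by G x n')"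
        using e_delta[OF q n] Q(2) by (auto simp: cQ n'_def)
      then show "c' x = \<one>" using x Q(2) n' by (simp add: c'_def m_assoc subsetD)
    next
      show "E \<lhd> G" "\<And>x y. x \<in> carrier G \<Longrightarrow> y \<in> carrier G \<Longrightarrow> conj_by G x y \<otimes> inv y \<in> E"
        using E by simp_all
    next
      fix x a r k assume "x \<in> E" "a \<in> A q" "Factorial_Ring.prime r" "r \<noteq> q" "x [^] (r ^ k :: nat) = \<one>"
      moreover have "coprime (r ^ k) q" using calculation q by (simp add: primes_coprime)
      ultimately show "conj_by G x a = a" using e(1)[OF q] tor by (intro E_cent)
    qed
    then obtain m where m: "m \<in> A q" "\<And>x. x \<in> J \<Longrightarrow> c' x = m \<otimes> inv (conj_by G x m)" by blast
    have "c x [^] e q = (n' \<otimes> m) \<otimes> inv (conj_by G x (n' \<otimes> m))" if "x \<in> J" for x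
      using that n' m cN by (intro principal_if_twist_principal) (auto simp: c'_def)
    then show ?thesis using n' m(1) A.m_closed by blast
  qed
  then have "\<forall>q. \<exists>n. Factorial_Ring.prime q \<longrightarrow>
      n \<in> A q \<and> (\<forall>x\<in>J. c x [^] e q = n \<otimes> inv (conj_by G x n))"
    by blast
  from choice[OF this] obtain \<nu> where "\<forall>q. Factorial_Ring.prime q \<longrightarrow>
      \<nu> q \<in> A q \<and> (\<forall>x\<in>J. c x [^] e q = \<nu> q \<otimes> inv (conj_by G x (\<nu> q)))" ..
  then have \<nu>: "\<And>q. Factorial_Ring.prime q \<Longrightarrow> \<nu> q \<in> A q"
    "\<And>q x. Factorial_Ring.prime q \<Longrightarrow> x \<in> J \<Longrightarrow> c x [^] e q = \<nu> q \<otimes> inv (conj_by G x (\<nu> q))"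
    by simp_all
  have e_other: "x [^] e q = \<one>" if qr: "Factorial_Ring.prime q" "Factorial_Ring.prime r" "r \<noteq> q" and x: "x \<in> A r" for q r x
  proof -
    have xN: "x \<in> N" using x AN by blast
    obtain k where k: "(x [^] e q) [^] (q ^ k) = \<one>" using e(3)[OF qr(1) xN] by (auto simp: A_def torsion_part_def)
    obtain l where l: "x [^] (r ^ l) = \<one>" using x by (auto simp: A_def torsion_part_def)
    have "(x [^] e q) [^] (r ^ l) = \<one>" using l xN by (metis N.mem_carrier mult.commute nat_pow_one nat_pow_pow)
    moreover have "coprime (q ^ k) (r ^ l)" using qr by (simp add: primes_coprime)
    ultimately show ?thesis using coprime_pow_eq_one[OF nat_pow_closed[OF N.mem_carrier[OF xN]] k] by blast
  qed
  have comb: "\<exists>n\<in>N. \<forall>q\<in>F. n [^] e q = \<nu> q" if "finite F" "\<forall>q\<in>F. Factorial_Ring.prime q" for F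
    using that
  proof (induction F)
    case empty
    then show ?case using N.one_closed by blast
  next
    case (insert r F)
    then obtain n where n: "n \<in> N" "\<And>q. q \<in> F \<Longrightarrow> n [^] e q = \<nu> q" by auto
    have r: "Factorial_Ring.prime r" using insert by simp
    have nr: "n [^] e r \<in> A r" "\<nu> r \<in> A r" "n [^] e r \<in> N" "\<nu> r \<in> N"
      using e(3)[OF r n(1)] \<nu>(1)[OF r] AN by blast+
    \<comment> \<open>Replace the \<open>r\<close>-part of \<open>n\<close>, which is \<open>n [^] e r\<close>, by \<open>\<nu> r\<close>.\<close>
    have "(n \<otimes> inv (n [^] e r) \<otimes> \<nu> r) [^] e q = n [^] e q \<otimes> inv ((n [^] e r) [^] e q) \<otimes> \<nu> r [^] e q"
      if "Factorial_Ring.prime q" for q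
      using that nr n(1) by (simp add: e(2) e_inv)
    moreover have "(n [^] e r) [^] e q = \<one>" "\<nu> r [^] e q = \<one>" "\<nu> q \<in> carrier G" if "q \<in> F" for q
    proof -
      have q: "Factorial_Ring.prime q" "r \<noteq> q" using that insert.prems insert.hyps(2) by auto
      show "(n [^] e r) [^] e q = \<one>" "\<nu> r [^] e q = \<one>"
        using e_other[OF q(1) r q(2)] nr by blast+
      show "\<nu> q \<in> carrier G" using N.mem_carrier[OF subsetD[OF AN \<nu>(1)[OF q(1)]]] .
    qed
    ultimately have "\<forall>q\<in>insert r F. (n \<otimes> inv (n [^] e r) \<otimes> \<nu> r) [^] e q = \<nu> q"
      using insert.prems nr n r by (simp add: e(4))
    moreover have "n \<otimes> inv (n [^] e r) \<otimes> \<nu> r \<in> N" using nr n by simp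
    ultimately show ?case by blast
  qed
  have nzN: "card N \<noteq> 0" using N.finite_imp_card_positive[OF fin] by simp
  define F where "F = {q. Factorial_Ring.prime q \<and> q dvd card N}"
  have "F \<subseteq> {..card N}" using nzN by (auto simp: F_def intro!: dvd_imp_le)
  then have finF: "finite F" using finite_subset by blast
  have "\<forall>q\<in>F. Factorial_Ring.prime q" by (simp add: F_def)
  then obtain n where n: "n \<in> N" "\<And>q. q \<in> F \<Longrightarrow> n [^] e q = \<nu> q" using comb[OF finF] by blast
  have "c x = n \<otimes> inv (conj_by G x n)" if x: "x \<in> J" for x
  proof -
    define z where "z = c x \<otimes> inv (n \<otimes> inv (conj_by G x n))"
    have dN: "n \<otimes> inv (conj_by G x n) \<in> N" using n x normal_conj_by[OF N] by simp
    have zN: "z \<in> N" using dN cN[OF x] by (simp add: z_def)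
    have zq: "z [^] e q = \<one>" if "q \<in> F" for q
    proof -
      have q: "Factorial_Ring.prime q" using that by (simp add: F_def)
      have "z [^] e q = c x [^] e q \<otimes> inv ((n \<otimes> inv (conj_by G x n)) [^] e q)"
        using dN cN[OF x] q by (simp add: z_def e(2) e_inv)
      also have "\<dots> = \<one>"
        using e_delta[OF q n(1) x] n(2)[OF that] \<nu>(2)[OF q x, symmetric] cN[OF x] by simp
      finally show ?thesis .
    qed
    have "z = \<one>"
    proof (rule ccontr)
      assume "z \<noteq> \<one>"
      have zG: "z \<in> carrier G" using zN by simp
      have "ord z \<noteq> 1" using \<open>z \<noteq> \<one>\<close> zG ord_eq_1 by blast
      then obtain q where q: "Factorial_Ring.prime q" "q dvd ord z" using prime_factor_nat by blast
      have "ord z dvd card N" using pow_eq_id[OF zG] pow_card_subgroup[OF N.subgroup_axioms zN] by simp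
      then have qF: "q \<in> F" using q by (auto simp: F_def)
      obtain k where k: "ord z = q * k" using q(2) by blast
      \<comment> \<open>A power of \<open>z\<close> of prime order \<open>q\<close> is its own \<open>q\<close>-part, yet \<open>z\<close> has trivial \<open>q\<close>-part.\<close>
      define y where "y = z [^] k"
      have "ord z > 0" using \<open>ord z dvd card N\<close> nzN dvd_pos_nat by blast
      then have "k > 0" "k < ord z" using k prime_gt_1_nat[OF q(1)] by auto
      then have "y \<noteq> \<one>" unfolding y_def using pow_eq_id[OF zG] by (auto dest: dvd_imp_le)
      have "y [^] q = \<one>" unfolding y_def using zG k pow_ord_eq_1[OF zG] by (simp add: nat_pow_pow mult.commute)
      then have "y \<in> A q" using subgroup_nat_pow[OF N.subgroup_axioms zN]
        by (auto simp: A_def torsion_part_def y_def intro!: exI[of _ 1])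
      then have "y = (z [^] e q) [^] k" using e(4)[OF q(1)] zG
        by (metis mult.commute nat_pow_pow y_def)
      then show False using zq[OF qF] \<open>y \<noteq> \<one>\<close> by simp
    qed
    then show ?thesis using dN cN[OF x] inv_solve_right'[of \<one> "c x"] unfolding z_def by simp
  qed
  then show ?thesis using n(1) by blast
qed

lemma conjugate_in_iff:
  assumes "H \<subseteq> carrier G"
  shows "conjugate_in G H K \<longleftrightarrow> (\<exists>g\<in>carrier G. K = conj_by G g ` H)"
proof -
  have "(g <#\<^bsub>G\<^esub> H) #> inv g = conj_by G g ` H" for g
    by (auto simp: l_coset_def r_coset_def conj_by_def)
  then show ?thesis by (simp add: conjugate_in_def)
qed

lemma conj_by_inj: "g \<in> carrier G \<Longrightarrow> inj_on (conj_by G g) (carrier G)"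
  by (metis conj_by_inv_cancel(2) inj_onI)

lemma subgroup_conj_by: "g \<in> carrier G \<Longrightarrow> subgroup H G \<Longrightarrow> subgroup (conj_by G g ` H) G"
  using group_hom.subgroup_img_is_subgroup[OF conj_by_group_hom] .

lemma card_conj_by: "g \<in> carrier G \<Longrightarrow> subgroup H G \<Longrightarrow> card (conj_by G g ` H) = card H"
  using card_image inj_on_subset[OF conj_by_inj subgroup.subset] by blast

lemma sylow_subgroup_iff:
  assumes "subgroup J G"
  shows "sylow_subgroup (G\<lparr>carrier := J\<rparr>) p P \<longleftrightarrow>
    subgroup P G \<and> P \<subseteq> J \<and> card P = p ^ multiplicity p (card J)"
proof -
  have "subgroup P (G\<lparr>carrier := J\<rparr>) \<longleftrightarrow> subgroup P G \<and> P \<subseteq> J"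
    using subgroup_incl[OF _ assms] incl_subgroup[OF assms] subgroup.subset[of P "G\<lparr>carrier := J\<rparr>"]
    by auto
  then show ?thesis by (auto simp: sylow_subgroup_def order_def)
qed

lemma conjugate_imp_locally_conjugate:
  assumes fin: "finite (carrier G)" and J: "subgroup J G" and conj: "conjugate_in G J J'"
  shows "locally_conjugate G J J'"
  unfolding locally_conjugate_def
proof (intro allI impI)
  fix p :: nat assume p: "Factorial_Ring.prime p"
  obtain g where g: "g \<in> carrier G" "J' = conj_by G g ` J"
    using conj conjugate_in_iff[OF subgroup.subset[OF J]] by blast
  have J': "subgroup J' G" "card J' = card J" using g J by (simp_all add: subgroup_conj_by card_conj_by)
  obtain P where P: "subgroup P G" "P \<subseteq> J" "card P = p ^ multiplicity p (card J)"
    using sylow_exists[OF fin J p] by blast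
  have "sylow_subgroup (G\<lparr>carrier := J'\<rparr>) p (conj_by G g ` P)"
    using P g J' by (auto simp: sylow_subgroup_iff subgroup_conj_by card_conj_by)
  moreover have "conjugate_in G P (conj_by G g ` P)"
    using conjugate_in_iff[OF subgroup.subset[OF P(1)]] g(1) by blast
  ultimately show "\<exists>P P'. sylow_subgroup (G\<lparr>carrier := J\<rparr>) p P \<and>
      sylow_subgroup (G\<lparr>carrier := J'\<rparr>) p P' \<and> conjugate_in G P P'"
    using P J by (auto simp: sylow_subgroup_iff)
qed

lemma complement_decompose:
  assumes "is_complement G N K" "x \<in> carrier G"
  shows "\<exists>n\<in>N. \<exists>k\<in>K. x = n \<otimes> k"
proof -
  have "x \<in> N <#> K" using assms by (simp add: is_complement_def)
  then show ?thesis by (auto simp: set_mult_def)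
qed

text \<open>
  Modulo \<open>N\<close> every \<open>x \<in> J\<close> agrees with exactly one element of \<open>J'\<close>, which is written \<open>c x \<otimes> x\<close>. The
  last clause is this uniqueness.
\<close>
lemma complement_crossed_hom:
  assumes J: "is_complement G N J" and J': "is_complement G N J'"
  shows "\<exists>c. crossed_hom G J N c \<and> J' = (\<lambda>x. c x \<otimes> x) ` J \<and>
    (\<forall>x\<in>J. \<forall>n\<in>N. n \<otimes> x \<in> J' \<longrightarrow> c x = n)"
proof -
  have N: "N \<lhd> G" and sJ: "subgroup J G" and sJ': "subgroup J' G" and triv: "N \<inter> J' = {\<one>}"
    using J J' unfolding is_complement_def by simp_all
  interpret N: subgroup N G using N by (rule normal_imp_subgroup)
  interpret J: subgroup J G by (rule sJ)
  interpret J': subgroup J' G by (rule sJ')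
  have ex: "\<exists>n\<in>N. n \<otimes> x \<in> J'" if x: "x \<in> J" for x
  proof -
    obtain n k where nk: "n \<in> N" "k \<in> J'" "x = n \<otimes> k"
      using complement_decompose[OF J' J.mem_carrier[OF x]] by blast
    then have "inv n \<otimes> x \<in> J'" by simp
    then show ?thesis using nk(1) N.m_inv_closed by blast
  qed
  have unique: "m = n" if "m \<in> N" "n \<in> N" "x \<in> J" "m \<otimes> x \<in> J'" "n \<otimes> x \<in> J'" for m n x
  proof -
    have "m \<otimes> x \<otimes> inv (n \<otimes> x) \<in> J'" using that(4,5) by simp
    moreover have "m \<otimes> x \<otimes> inv (n \<otimes> x) = m \<otimes> inv n"
      using that(1-3) by (simp add: m_assoc inv_mult_group)
    ultimately have "m \<otimes> inv n \<in> N \<inter> J'" using that(1,2) by simp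
    then have "m \<otimes> inv n = \<one>" using triv by simp
    then show ?thesis using that(1,2) inv_solve_right'[of \<one> m n] by simp
  qed
  define c where "c = (\<lambda>x. SOME n. n \<in> N \<and> n \<otimes> x \<in> J')"
  have c: "c x \<in> N" "c x \<otimes> x \<in> J'" if "x \<in> J" for x
    using someI_ex[of "\<lambda>n. n \<in> N \<and> n \<otimes> x \<in> J'"] ex[OF that] by (auto simp: c_def)
  have cu: "c x = n" if "x \<in> J" "n \<in> N" "n \<otimes> x \<in> J'" for x n
    using unique[OF c(1) that(2,1) c(2) that(3)] that(1) by simp
  have "c (x \<otimes> y) = c x \<otimes> conj_by G x (c y)" if xy: "x \<in> J" "y \<in> J" for x y
  proof (rule cu)
    show "x \<otimes> y \<in> J" using xy by simp
    show "c x \<otimes> conj_by G x (c y) \<in> N" using xy c(1) normal_conj_by[OF N] by simp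
    have "c x \<otimes> conj_by G x (c y) \<otimes> (x \<otimes> y) = (c x \<otimes> x) \<otimes> (c y \<otimes> y)"
      using xy c(1) by (simp add: conj_by_def m_assoc)
    then show "c x \<otimes> conj_by G x (c y) \<otimes> (x \<otimes> y) \<in> J'" using c(2) xy by simp
  qed
  then have "crossed_hom G J N c" using c(1) by (auto simp: crossed_hom_def)
  moreover have "J' = (\<lambda>x. c x \<otimes> x) ` J"
  proof
    show "(\<lambda>x. c x \<otimes> x) ` J \<subseteq> J'" using c(2) by blast
    show "J' \<subseteq> (\<lambda>x. c x \<otimes> x) ` J"
    proof
      fix y assume y: "y \<in> J'"
      obtain n x where nx: "n \<in> N" "x \<in> J" "y = n \<otimes> x"
        using complement_decompose[OF J J'.mem_carrier[OF y]] by blast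
      then show "y \<in> (\<lambda>x. c x \<otimes> x) ` J" using cu[of x n] y by auto
    qed
  qed
  ultimately show ?thesis using cu by blast
qed

text \<open>
  If \<open>g = n \<otimes> j\<close> conjugates the Sylow subgroup \<open>P\<close> of \<open>J\<close> into \<open>J'\<close>, then \<open>n\<close> alone conjugates the
  Sylow subgroup \<open>Q = conj_by G j ` P\<close> of \<open>J\<close> into \<open>J'\<close>. Conjugation by \<open>n\<close> does not change classes
  modulo \<open>N\<close>, so on \<open>Q\<close> the crossed homomorphism of \<open>J'\<close> is the principal one of \<open>n\<close>.
\<close>
lemma locally_conjugate_complements_imp_conjugate:
  assumes fin: "finite (carrier G)" and ss: "supersoluble G" and nil: "nilpotent_group (G\<lparr>carrier := N\<rparr>)"
    and J: "is_complement G N J" and J': "is_complement G N J'" and loc: "locally_conjugate G J J'"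
  shows "conjugate_in G J J'"
proof -
  have N: "N \<lhd> G" and sJ: "subgroup J G" and sJ': "subgroup J' G"
    using J J' unfolding is_complement_def by simp_all
  interpret N: subgroup N G using N by (rule normal_imp_subgroup)
  interpret J: subgroup J G by (rule sJ)
  obtain c where c: "crossed_hom G J N c" and J'_eq: "J' = (\<lambda>x. c x \<otimes> x) ` J"
    and cu: "\<And>x n. x \<in> J \<Longrightarrow> n \<in> N \<Longrightarrow> n \<otimes> x \<in> J' \<Longrightarrow> c x = n"
    using complement_crossed_hom[OF J J'] by blast
  have "\<exists>n\<in>N. \<forall>x\<in>J. c x = n \<otimes> inv (conj_by G x n)"
  proof (rule crossed_hom_principal_if_locally_principal[OF fin ss sJ N nil c])
    fix q :: nat assume q: "Factorial_Ring.prime q"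
    obtain P P' where P: "subgroup P G" "P \<subseteq> J" "card P = q ^ multiplicity q (card J)"
      and P': "P' \<subseteq> J'" and "conjugate_in G P P'"
      using loc q sJ sJ' by (auto simp: locally_conjugate_def sylow_subgroup_iff)
    then obtain g where g: "g \<in> carrier G" "P' = conj_by G g ` P"
      using conjugate_in_iff[OF subgroup.subset[OF P(1)]] by blast
    obtain n j where nj: "n \<in> N" "j \<in> J" "g = n \<otimes> j" using complement_decompose[OF J g(1)] by blast
    define Q where "Q = conj_by G j ` P"
    have QJ: "Q \<subseteq> J" using nj(2) P(2) by (auto simp: Q_def conj_by_def)
    have "c x = n \<otimes> inv (conj_by G x n)" if x: "x \<in> Q" for x
    proof (rule cu)
      show xJ: "x \<in> J" using x QJ by blast
      show "n \<otimes> inv (conj_by G x n) \<in> N" using nj(1) xJ normal_conj_by[OF N] by simp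
      obtain y where y: "y \<in> P" "x = conj_by G j y" using x by (auto simp: Q_def)
      have yG: "y \<in> carrier G" using y(1) P(2) by auto
      have "n \<otimes> inv (conj_by G x n) \<otimes> x = conj_by G n x"
        using nj(1) xJ by (simp add: conj_by_def m_assoc inv_mult_group)
      also have "\<dots> = conj_by G g y" using nj y(2) yG by (simp add: conj_by_conj_by)
      also have "\<dots> \<in> J'" using y(1) g(2) P' by blast
      finally show "n \<otimes> inv (conj_by G x n) \<otimes> x \<in> J'" .
    qed
    then show "\<exists>Q n. subgroup Q G \<and> Q \<subseteq> J \<and> card Q = q ^ multiplicity q (card J) \<and> n \<in> N \<and>
        (\<forall>x\<in>Q. c x = n \<otimes> inv (conj_by G x n))"
      using QJ nj P by (intro exI[of _ Q] exI[of _ n]) (simp add: Q_def subgroup_conj_by card_conj_by)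
  qed
  then obtain n where n: "n \<in> N" "\<And>x. x \<in> J \<Longrightarrow> c x = n \<otimes> inv (conj_by G x n)" by blast
  have "c x \<otimes> x = conj_by G n x" if "x \<in> J" for x
    using that n by (simp add: conj_by_def m_assoc inv_mult_group)
  then have "J' = conj_by G n ` J" unfolding J'_eq by (intro image_cong) auto
  then have "\<exists>g\<in>carrier G. J' = conj_by G g ` J" using N.mem_carrier[OF n(1)] by blast
  then show ?thesis using conjugate_in_iff[OF J.subset] by simp
qed

end

theorem lemma2:
  fixes G :: "('a, 'b) monoid_scheme" and N J J' :: "'a set"
  assumes "group G" and "finite (carrier G)" and "supersoluble G"
    and "N \<lhd> G" and "nilpotent_group (G\<lparr>carrier := N\<rparr>)"
    and "is_complement G N J" and "is_complement G N J'"
  shows "conjugate_in G J J' \<longleftrightarrow> locally_conjugate G J J'"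
proof
  interpret group G by fact
  show "locally_conjugate G J J'" if "conjugate_in G J J'"
    using conjugate_imp_locally_conjugate[OF assms(2) _ that] assms(6) by (simp add: is_complement_def)
  show "conjugate_in G J J'" if "locally_conjugate G J J'"
    using locally_conjugate_complements_imp_conjugate[OF assms(2,3,5,6,7) that] .
qed

end
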